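(* Let $(X,\mathcal B,m)$ be a measure space with $m$ localizable. Every Dirichlet form on $L^2(m)$ is closable on $L^0(m)$; that is, if $\mathcal E$ is a Dirichlet form on $L^2(m)$, extended to $L^0(m)$ by $\mathcal E(f)=\infty$ for $f\in L^0(m)\setminus L^2(m)$, then there is a closed quadratic form on $L^0(m)$ that extends $\mathcal E$.
   Context: A measure $m$ is localizable if it is semi-finite and every family $\mathcal A\subseteq\mathcal B$ has an essential supremum $S\in\mathcal B$, i.e. $m(A\setminus S)=0$ for all $A\in\mathcal A$, and $m(S\setminus G)=0$ whenever $G\in\mathcal B$ satisfies $m(A\setminus G)=0$ for all $A\in\mathcal A$. $L^0(m)$ is the space of real-valued measurable functions modulo $m$-a.e. equality, with the topology of local convergence in measure: $f_i\to f$ iff $\int_U|f_i-f|\wedge1\,dm\to0$ for every measurable $U$ with $m(U)<\infty$. A quadratic form on a real vector space $V$ is a map $q:V\to[0,\infty]$ with $2q(u)+2q(v)=q(u+v)+q(u-v)$ and $q(\lambda u)=|\lambda|^2q(u)$ ($0\cdot\infty=0$), $D(q)=\{q<\infty\}$. On a topological vector space $(V,\tau)$, $q$ is closed if $D(q)$ is complete in the smallest topology containing the subspace topology of $\tau$ and the topology of the seminorm $q^{1/2}$. A form $\tilde q$ extends $q$ if $D(q)\subseteq D(\tilde q)$ and $\tilde q=q$ on $D(q)$; $q$ is closable if it has a closed extension. A normal contraction $C:\mathbb R\to\mathbb R$ satisfies $C(0)=0$, $|C(x)-C(y)|\le|x-y|$; an $\varepsilon$-cutoff is a monotone increasing normal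 contraction with values in $[-\varepsilon,1+\varepsilon]$ and $C(x)=x$ for $x\in[0,1]$. A quadratic form $\mathcal E$ on $L^2(m)$ is Markovian if for each $\varepsilon>0$ there is an $\varepsilon$-cutoff $C_\varepsilon$ with $\mathcal E(C_\varepsilon\circ u)\le\mathcal E(u)$ for all $u\in L^2(m)$. A Dirichlet form is a closed Markovian form on $L^2(m)$ (its domain need not be dense). *)

theory Defs
  imports "HOL-Analysis.Analysis"
begin

section \<open>Localizable measures\<close>

text \<open>The library locale \<open>semifinite_measure\<close> is not used: it omits \<open>0 < emeasure M B\<close>
  and is therefore satisfied by every measure (take the empty set for \<open>B\<close>).\<close>

definition semi_finite :: "'a measure \<Rightarrow> bool" where
  "semi_finite M \<longleftrightarrow>
    (\<forall>A\<in>sets M. emeasure M A = \<infinity> \<longrightarrow>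
      (\<exists>B\<in>sets M. B \<subseteq> A \<and> 0 < emeasure M B \<and> emeasure M B < \<infinity>))"

definition is_ess_sup :: "'a measure \<Rightarrow> 'a set set \<Rightarrow> 'a set \<Rightarrow> bool" where
  "is_ess_sup M \<A> S \<longleftrightarrow>
    S \<in> sets M \<and>
    (\<forall>A\<in>\<A>. emeasure M (A - S) = 0) \<and>
    (\<forall>G\<in>sets M. (\<forall>A\<in>\<A>. emeasure M (A - G) = 0) \<longrightarrow> emeasure M (S - G) = 0)"

definition localizable :: "'a measure \<Rightarrow> bool" where
  "localizable M \<longleftrightarrow> semi_finite M \<and> (\<forall>\<A>. \<A> \<subseteq> sets M \<longrightarrow> (\<exists>S. is_ess_sup M \<A> S))"


section \<open>Closed quadratic forms on topological vector spaces\<close>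

text \<open>The spaces \<open>L\<^sup>0(m)\<close> and \<open>L\<^sup>2(m)\<close> depend on a measure and so are not types. A topological
  vector space is therefore a record with an explicit carrier.\<close>

record 'v tvs =
  vcarrier :: "'v set"
  vzero :: "'v"
  vadd :: "'v \<Rightarrow> 'v \<Rightarrow> 'v"
  vscale :: "real \<Rightarrow> 'v \<Rightarrow> 'v"
  vtop :: "'v topology"

definition vdiff :: "'v tvs \<Rightarrow> 'v \<Rightarrow> 'v \<Rightarrow> 'v" where
  "vdiff V u v = vadd V u (vscale V (-1) v)"

text \<open>The values of \<open>q\<close> outside the carrier are irrelevant. Multiplication on \<^typ>\<open>ennreal\<close>
  satisfies \<open>0 * \<infinity> = 0\<close>.\<close>

definition quadratic_form :: "'v tvs \<Rightarrow> ('v \<Rightarrow> ennreal) \<Rightarrow> bool" where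
  "quadratic_form V q \<longleftrightarrow>
    (\<forall>u\<in>vcarrier V. \<forall>v\<in>vcarrier V. 2 * q u + 2 * q v = q (vadd V u v) + q (vdiff V u v)) \<and>
    (\<forall>c. \<forall>u\<in>vcarrier V. q (vscale V c u) = ennreal (\<bar>c\<bar>\<^sup>2) * q u)"

definition form_domain :: "'v tvs \<Rightarrow> ('v \<Rightarrow> ennreal) \<Rightarrow> 'v set" where
  "form_domain V q = {u \<in> vcarrier V. q u < \<infinity>}"

definition form_seminorm :: "('v \<Rightarrow> ennreal) \<Rightarrow> 'v \<Rightarrow> real" where
  "form_seminorm q u = sqrt (enn2real (q u))"

definition pseudometric_topology :: "'v set \<Rightarrow> ('v \<Rightarrow> 'v \<Rightarrow> real) set \<Rightarrow> 'v topology" where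
  "pseudometric_topology S \<D> =
    topology_generated_by {{v \<in> S. d u v < r} | d u r. d \<in> \<D> \<and> u \<in> S \<and> 0 < r}"

definition seminorm_topology :: "'v tvs \<Rightarrow> ('v \<Rightarrow> ennreal) \<Rightarrow> 'v topology" where
  "seminorm_topology V q =
    pseudometric_topology (form_domain V q) {\<lambda>u v. form_seminorm q (vdiff V u v)}"

definition form_topology :: "'v tvs \<Rightarrow> ('v \<Rightarrow> ennreal) \<Rightarrow> 'v topology" where
  "form_topology V q = topology_generated_by
    ({W. openin (subtopology (vtop V) (form_domain V q)) W} \<union>
     {W. openin (seminorm_topology V q) W})"

text \<open>Completeness of a linear subspace, the carrier of the vector topology \<open>T\<close>, with respect to
  the uniformity that \<open>T\<close> induces. Filters are used instead of sequences because \<open>T\<close> need not be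
  metrizable.\<close>

definition vcauchy_filter :: "'v tvs \<Rightarrow> 'v topology \<Rightarrow> 'v filter \<Rightarrow> bool" where
  "vcauchy_filter V T F \<longleftrightarrow>
    (\<forall>W. openin T W \<and> vzero V \<in> W \<longrightarrow> (\<forall>\<^sub>F (u, v) in F \<times>\<^sub>F F. vdiff V u v \<in> W))"

definition vcomplete :: "'v tvs \<Rightarrow> 'v topology \<Rightarrow> bool" where
  "vcomplete V T \<longleftrightarrow>
    (\<forall>F \<le> principal (topspace T). F \<noteq> bot \<longrightarrow> vcauchy_filter V T F \<longrightarrow>
      (\<exists>u. limitin T (\<lambda>v. v) u F))"

definition closed_form :: "'v tvs \<Rightarrow> ('v \<Rightarrow> ennreal) \<Rightarrow> bool" where
  "closed_form V q \<longleftrightarrow> quadratic_form V q \<and> vcomplete V (form_topology V q)"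

definition form_extends :: "'v tvs \<Rightarrow> ('v \<Rightarrow> ennreal) \<Rightarrow> ('v \<Rightarrow> ennreal) \<Rightarrow> bool" where
  "form_extends V q' q \<longleftrightarrow>
    form_domain V q \<subseteq> form_domain V q' \<and> (\<forall>u\<in>form_domain V q. q' u = q u)"

definition closable_form :: "'v tvs \<Rightarrow> ('v \<Rightarrow> ennreal) \<Rightarrow> bool" where
  "closable_form V q \<longleftrightarrow> (\<exists>q'. closed_form V q' \<and> form_extends V q' q)"


section \<open>The spaces of measurable and of square integrable functions modulo a.e. equality\<close>

definition ae_rel :: "'a measure \<Rightarrow> (('a \<Rightarrow> real) \<times> ('a \<Rightarrow> real)) set" where
  "ae_rel M = {(f, g). f \<in> borel_measurable M \<and> g \<in> borel_measurable M \<and> (AE x in M. f x = g x)}"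

definition ae_class :: "'a measure \<Rightarrow> ('a \<Rightarrow> real) \<Rightarrow> ('a \<Rightarrow> real) set" where
  "ae_class M f = ae_rel M `` {f}"

definition rep :: "('a \<Rightarrow> real) set \<Rightarrow> 'a \<Rightarrow> real" where
  "rep u = (SOME f. f \<in> u)"

definition L0_classes :: "'a measure \<Rightarrow> ('a \<Rightarrow> real) set set" where
  "L0_classes M = borel_measurable M // ae_rel M"

definition L2_classes :: "'a measure \<Rightarrow> ('a \<Rightarrow> real) set set" where
  "L2_classes M = {u \<in> L0_classes M. integrable M (\<lambda>x. (rep u x)\<^sup>2)}"

definition local_dist ::
  "'a measure \<Rightarrow> 'a set \<Rightarrow> ('a \<Rightarrow> real) set \<Rightarrow> ('a \<Rightarrow> real) set \<Rightarrow> real" where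
  "local_dist M U u v = (LINT x:U|M. min \<bar>rep u x - rep v x\<bar> 1)"

definition L2_dist :: "'a measure \<Rightarrow> ('a \<Rightarrow> real) set \<Rightarrow> ('a \<Rightarrow> real) set \<Rightarrow> real" where
  "L2_dist M u v = sqrt (LINT x|M. (rep u x - rep v x)\<^sup>2)"

definition L0_space :: "'a measure \<Rightarrow> ('a \<Rightarrow> real) set tvs" where
  "L0_space M =
    \<lparr> vcarrier = L0_classes M,
      vzero = ae_class M (\<lambda>x. 0),
      vadd = (\<lambda>u v. ae_class M (\<lambda>x. rep u x + rep v x)),
      vscale = (\<lambda>c u. ae_class M (\<lambda>x. c * rep u x)),
      vtop = pseudometric_topology (L0_classes M)
        {local_dist M U | U. U \<in> sets M \<and> emeasure M U < \<infinity>} \<rparr>"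

definition L2_space :: "'a measure \<Rightarrow> ('a \<Rightarrow> real) set tvs" where
  "L2_space M = (L0_space M)
    \<lparr> vcarrier := L2_classes M, vtop := pseudometric_topology (L2_classes M) {L2_dist M} \<rparr>"


section \<open>Dirichlet forms\<close>

definition normal_contraction :: "(real \<Rightarrow> real) \<Rightarrow> bool" where
  "normal_contraction C \<longleftrightarrow> C 0 = 0 \<and> (\<forall>x y. \<bar>C x - C y\<bar> \<le> \<bar>x - y\<bar>)"

definition cutoff :: "real \<Rightarrow> (real \<Rightarrow> real) \<Rightarrow> bool" where
  "cutoff \<epsilon> C \<longleftrightarrow>
    normal_contraction C \<and> mono C \<and> range C \<subseteq> {-\<epsilon>..1 + \<epsilon>} \<and> (\<forall>x\<in>{0..1}. C x = x)"

definition class_comp :: "'a measure \<Rightarrow> (real \<Rightarrow> real) \<Rightarrow> ('a \<Rightarrow> real) set \<Rightarrow> ('a \<Rightarrow> real) set" where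
  "class_comp M C u = ae_class M (C \<circ> rep u)"

definition markovian :: "'a measure \<Rightarrow> (('a \<Rightarrow> real) set \<Rightarrow> ennreal) \<Rightarrow> bool" where
  "markovian M \<E> \<longleftrightarrow>
    (\<forall>\<epsilon>>0. \<exists>C. cutoff \<epsilon> C \<and> (\<forall>u\<in>L2_classes M. \<E> (class_comp M C u) \<le> \<E> u))"

definition dirichlet_form :: "'a measure \<Rightarrow> (('a \<Rightarrow> real) set \<Rightarrow> ennreal) \<Rightarrow> bool" where
  "dirichlet_form M \<E> \<longleftrightarrow> closed_form (L2_space M) \<E> \<and> markovian M \<E>"

definition extend_to_L0 ::
  "'a measure \<Rightarrow> (('a \<Rightarrow> real) set \<Rightarrow> ennreal) \<Rightarrow> ('a \<Rightarrow> real) set \<Rightarrow> ennreal" where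
  "extend_to_L0 M \<E> = (\<lambda>u. if u \<in> L2_classes M then \<E> u else \<infinity>)"


section \<open>Independence of representatives, and convergence\<close>

lemma equiv_ae_rel: "equiv (borel_measurable M) (ae_rel M)"
proof (rule equivI)
  show "ae_rel M \<subseteq> borel_measurable M \<times> borel_measurable M"
    by (auto simp: ae_rel_def)
  show "refl_on (borel_measurable M) (ae_rel M)"
    by (auto simp: refl_on_def ae_rel_def)
  show "sym (ae_rel M)"
    unfolding sym_def ae_rel_def by (auto elim!: eventually_mono)
  show "trans (ae_rel M)"
    unfolding trans_def ae_rel_def by (auto elim: eventually_elim2)
qed

lemma ae_class_in_L0: "f \<in> borel_measurable M \<Longrightarrow> ae_class M f \<in> L0_classes M"
  by (simp add: L0_classes_def ae_class_def quotientI)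

lemma ae_class_eq_iff:
  assumes "f \<in> borel_measurable M" "g \<in> borel_measurable M"
  shows "ae_class M f = ae_class M g \<longleftrightarrow> (AE x in M. f x = g x)"
  unfolding ae_class_def using eq_equiv_class_iff[OF equiv_ae_rel assms] assms
  by (auto simp: ae_rel_def)

lemma rep_ae_class:
  assumes "f \<in> borel_measurable M"
  shows "rep (ae_class M f) \<in> borel_measurable M" "AE x in M. rep (ae_class M f) x = f x"
proof -
  have "f \<in> ae_class M f"
    using assms by (simp add: ae_class_def ae_rel_def)
  then have "rep (ae_class M f) \<in> ae_class M f"
    unfolding rep_def by (rule someI[where P = "\<lambda>g. g \<in> ae_class M f"])
  then have *: "(f, rep (ae_class M f)) \<in> ae_rel M"
    by (simp add: ae_class_def)
  show "rep (ae_class M f) \<in> borel_measurable M"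
    using * by (simp add: ae_rel_def)
  have "AE x in M. f x = rep (ae_class M f) x"
    using * by (simp add: ae_rel_def)
  then show "AE x in M. rep (ae_class M f) x = f x"
    by eventually_elim simp
qed

lemma L0_classesE:
  assumes "u \<in> L0_classes M"
  obtains f where "f \<in> borel_measurable M" "u = ae_class M f"
  using assms by (auto simp: L0_classes_def ae_class_def elim: quotientE)

lemma vadd_ae_class:
  assumes [measurable]: "f \<in> borel_measurable M" "g \<in> borel_measurable M"
  shows "vadd (L0_space M) (ae_class M f) (ae_class M g) = ae_class M (\<lambda>x. f x + g x)"
proof -
  note [measurable] = rep_ae_class(1)[OF assms(1)] rep_ae_class(1)[OF assms(2)]
  have "AE x in M. rep (ae_class M f) x + rep (ae_class M g) x = f x + g x"
    using rep_ae_class(2)[OF assms(1)] rep_ae_class(2)[OF assms(2)] by eventually_elim simp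
  then show ?thesis
    by (simp add: L0_space_def ae_class_eq_iff)
qed

lemma vscale_ae_class:
  assumes [measurable]: "f \<in> borel_measurable M"
  shows "vscale (L0_space M) c (ae_class M f) = ae_class M (\<lambda>x. c * f x)"
proof -
  note [measurable] = rep_ae_class(1)[OF assms(1)]
  have "AE x in M. c * rep (ae_class M f) x = c * f x"
    using rep_ae_class(2)[OF assms(1)] by eventually_elim simp
  then show ?thesis
    by (simp add: L0_space_def ae_class_eq_iff)
qed

lemma ae_class_in_L2_iff:
  assumes [measurable]: "f \<in> borel_measurable M"
  shows "ae_class M f \<in> L2_classes M \<longleftrightarrow> integrable M (\<lambda>x. (f x)\<^sup>2)"
proof -
  note [measurable] = rep_ae_class(1)[OF assms(1)]
  have "AE x in M. (rep (ae_class M f) x)\<^sup>2 = (f x)\<^sup>2"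
    using rep_ae_class(2)[OF assms(1)] by eventually_elim simp
  then have "integrable M (\<lambda>x. (rep (ae_class M f) x)\<^sup>2) \<longleftrightarrow> integrable M (\<lambda>x. (f x)\<^sup>2)"
    by (intro integrable_cong_AE) auto
  then show ?thesis
    by (simp add: L2_classes_def ae_class_in_L0)
qed

lemma normal_contraction_borel:
  assumes "normal_contraction C"
  shows "C \<in> borel_measurable borel"
proof -
  have "1-lipschitz_on UNIV C"
    using assms by (auto simp: lipschitz_on_def normal_contraction_def dist_real_def)
  then show ?thesis
    by (intro borel_measurable_continuous_onI lipschitz_on_continuous_on)
qed

lemma class_comp_ae_class:
  assumes [measurable]: "f \<in> borel_measurable M" and C: "normal_contraction C"
  shows "class_comp M C (ae_class M f) = ae_class M (\<lambda>x. C (f x))"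
proof -
  note [measurable] = rep_ae_class(1)[OF assms(1)] normal_contraction_borel[OF C]
  have "AE x in M. C (rep (ae_class M f) x) = C (f x)"
    using rep_ae_class(2)[OF assms(1)] by eventually_elim simp
  then show ?thesis
    by (simp add: class_comp_def ae_class_eq_iff comp_def)
qed

lemma local_dist_ae_class:
  assumes [measurable]: "f \<in> borel_measurable M" "g \<in> borel_measurable M" "U \<in> sets M"
  shows "local_dist M U (ae_class M f) (ae_class M g) = (LINT x:U|M. min \<bar>f x - g x\<bar> 1)"
proof -
  note [measurable] = rep_ae_class(1)[OF assms(1)] rep_ae_class(1)[OF assms(2)]
  have "AE x in M. indicator U x *\<^sub>R min \<bar>rep (ae_class M f) x - rep (ae_class M g) x\<bar> 1 =
      (indicator U x *\<^sub>R min \<bar>f x - g x\<bar> 1 :: real)"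
    using rep_ae_class(2)[OF assms(1)] rep_ae_class(2)[OF assms(2)] by eventually_elim simp
  then show ?thesis
    unfolding local_dist_def set_lebesgue_integral_def by (intro integral_cong_AE) auto
qed

lemma limitin_pseudometric_topology:
  assumes l: "l \<in> S" and ne: "\<D> \<noteq> {}"
    and refl: "\<And>d. d \<in> \<D> \<Longrightarrow> d l l = 0"
    and tri: "\<And>d u v. d \<in> \<D> \<Longrightarrow> u \<in> S \<Longrightarrow> v \<in> S \<Longrightarrow> d u v \<le> d u l + d l v"
    and ev: "\<forall>\<^sub>F i in F. f i \<in> S"
  shows "limitin (pseudometric_topology S \<D>) f l F \<longleftrightarrow>
    (\<forall>d\<in>\<D>. \<forall>r>0. \<forall>\<^sub>F i in F. d l (f i) < r)"
proof
  assume lim: "limitin (pseudometric_topology S \<D>) f l F"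
  show "\<forall>d\<in>\<D>. \<forall>r>0. \<forall>\<^sub>F i in F. d l (f i) < r"
  proof (intro ballI allI impI)
    fix d r assume dr: "d \<in> \<D>" "(0::real) < r"
    have "openin (pseudometric_topology S \<D>) {v \<in> S. d l v < r}"
      unfolding pseudometric_topology_def
      by (rule topology_generated_by_Basis) (use dr l in blast)
    moreover have "l \<in> {v \<in> S. d l v < r}"
      using l dr refl[OF dr(1)] by simp
    ultimately have "\<forall>\<^sub>F i in F. f i \<in> {v \<in> S. d l v < r}"
      by (rule limitinD[OF lim])
    then show "\<forall>\<^sub>F i in F. d l (f i) < r"
      by eventually_elim simp
  qed
next
  assume R: "\<forall>d\<in>\<D>. \<forall>r>0. \<forall>\<^sub>F i in F. d l (f i) < r"
  have "l \<in> topspace (pseudometric_topology S \<D>)"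
  proof -
    obtain d where d: "d \<in> \<D>"
      using ne by blast
    have "l \<in> {v \<in> S. d l v < 1}"
      using l refl[OF d] by simp
    then show ?thesis
      unfolding pseudometric_topology_def topology_generated_by_topspace
      using d l zero_less_one by blast
  qed
  moreover have "\<forall>\<^sub>F i in F. f i \<in> W" if "openin (pseudometric_topology S \<D>) W" "l \<in> W" for W
  proof -
    have "generate_topology_on {{v \<in> S. d u v < r} | d u r. d \<in> \<D> \<and> u \<in> S \<and> 0 < r} W"
      using that(1) unfolding pseudometric_topology_def by (rule openin_topology_generated_by)
    then show ?thesis
      using that(2)
    proof induction
      case (Int a b)
      then show ?case
        by (auto intro: eventually_conj)
    next
      case (UN K)
      then obtain k where "k \<in> K" "l \<in> k" "\<forall>\<^sub>F i in F. f i \<in> k"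
        by blast
      then show ?case
        by (auto elim!: eventually_mono)
    next
      case (Basis s)
      then obtain d u r where s: "s = {v \<in> S. d u v < r}" and d: "d \<in> \<D>" and u: "u \<in> S"
        by blast
      then have "0 < r - d u l"
        using Basis by simp
      then have "\<forall>\<^sub>F i in F. d l (f i) < r - d u l"
        using R d by blast
      with ev show ?case
      proof eventually_elim
        case (elim i)
        then show ?case
          using tri[OF d u, of "f i"] by (simp add: s)
      qed
    qed simp
  qed
  ultimately show "limitin (pseudometric_topology S \<D>) f l F"
    by (auto simp: limitin_def)
qed

text \<open>The topology of \<^const>\<open>L0_space\<close> is that of local convergence in measure.\<close>

lemma limitin_L0_space:
  assumes f: "f \<in> borel_measurable M" and h: "\<And>i. h i \<in> borel_measurable M"
  shows "limitin (vtop (L0_space M)) (\<lambda>i. ae_class M (h i)) (ae_class M f) F \<longleftrightarrow>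
    (\<forall>U\<in>sets M. emeasure M U < \<infinity> \<longrightarrow>
      ((\<lambda>i. LINT x:U|M. min \<bar>h i x - f x\<bar> 1) \<longlongrightarrow> 0) F)"
proof -
  let ?D = "{local_dist M U | U. U \<in> sets M \<and> emeasure M U < \<infinity>}"
  have tri: "local_dist M U u v \<le> local_dist M U u w + local_dist M U w v"
    if U: "U \<in> sets M" "emeasure M U < \<infinity>" and uvw: "u \<in> L0_classes M" "v \<in> L0_classes M" "w \<in> L0_classes M"
    for U u v w
  proof -
    have meas[measurable]: "rep t \<in> borel_measurable M" if "t \<in> L0_classes M" for t
      using that by (elim L0_classesE) (simp add: rep_ae_class)
    note [measurable] = meas[OF uvw(1)] meas[OF uvw(2)] meas[OF uvw(3)] U(1)
    have int: "integrable M (\<lambda>x. indicator U x *\<^sub>R (min \<bar>a x - b x\<bar> 1 :: real))"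
      if [measurable]: "a \<in> borel_measurable M" "b \<in> borel_measurable M" for a b
      by (rule integrableI_bounded_set_indicator[where B = 1]) (use U in auto)
    have i1: "integrable M (\<lambda>x. indicator U x *\<^sub>R (min \<bar>rep u x - rep w x\<bar> 1 :: real))"
      and i2: "integrable M (\<lambda>x. indicator U x *\<^sub>R (min \<bar>rep w x - rep v x\<bar> 1 :: real))"
      and i3: "integrable M (\<lambda>x. indicator U x *\<^sub>R (min \<bar>rep u x - rep v x\<bar> 1 :: real))"
      by (rule int; measurable)+
    show ?thesis
      unfolding local_dist_def set_lebesgue_integral_def Bochner_Integration.integral_add[OF i1 i2, symmetric]
      by (intro integral_mono i3 Bochner_Integration.integrable_add i1 i2)
         (auto simp: indicator_def)
  qed
  have "limitin (vtop (L0_space M)) (\<lambda>i. ae_class M (h i)) (ae_class M f) F \<longleftrightarrow>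
      (\<forall>d\<in>?D. \<forall>r>0. \<forall>\<^sub>F i in F. d (ae_class M f) (ae_class M (h i)) < r)"
    unfolding L0_space_def tvs.simps
  proof (rule limitin_pseudometric_topology)
    show "?D \<noteq> {}"
      using sets.empty_sets[of M] emeasure_empty[of M] by fastforce
    show "d (ae_class M f) (ae_class M f) = 0" if "d \<in> ?D" for d
      using that by (auto simp: local_dist_def set_lebesgue_integral_def)
    show "d u v \<le> d u (ae_class M f) + d (ae_class M f) v"
      if "d \<in> ?D" "u \<in> L0_classes M" "v \<in> L0_classes M" for d u v
      using that tri ae_class_in_L0[OF f] by blast
  qed (auto simp: ae_class_in_L0 f h)
  also have "\<dots> \<longleftrightarrow> (\<forall>U\<in>sets M. emeasure M U < \<infinity> \<longrightarrow>
      (\<forall>r>0. \<forall>\<^sub>F i in F. (LINT x:U|M. min \<bar>h i x - f x\<bar> 1) < r))"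
    using local_dist_ae_class[OF f h] by (auto simp: abs_minus_commute)
  also have "\<dots> \<longleftrightarrow> (\<forall>U\<in>sets M. emeasure M U < \<infinity> \<longrightarrow>
      ((\<lambda>i. LINT x:U|M. min \<bar>h i x - f x\<bar> 1) \<longlongrightarrow> 0) F)"
  proof -
    have "\<bar>LINT x:U|M. min \<bar>h i x - f x\<bar> 1\<bar> = (LINT x:U|M. min \<bar>h i x - f x\<bar> 1)" for U i
      unfolding set_lebesgue_integral_def by (rule abs_of_nonneg, rule integral_nonneg_AE) auto
    then show ?thesis
      by (simp add: tendsto_iff dist_real_def)
  qed
  finally show ?thesis .
qed

end

theory Submission
  imports Defs
begin

text \<open>The extension is the lower semicontinuous relaxation of \<open>\<E>\<close> on \<open>L\<^sup>0\<close>. It is a quadratic form, and it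
  is closed because it is lower semicontinuous and \<open>L\<^sup>0\<close> is complete: the local limits of a Cauchy
  filter on sets of finite measure are glued by localizability. It remains to see that \<open>\<E>\<close> itself
  is lower semicontinuous with respect to \<open>L\<^sup>0\<close> at each \<open>v\<close> in its domain. Let \<open>d \<rightarrow> v\<close> locally in
  measure with \<open>\<E> d \<le> c\<close> and write \<open>d = v + p - n\<close> with nonnegative \<open>p, n \<rightarrow> 0\<close>, whose energies are
  bounded since the positive part decreases energy. If the pairs \<open>(p, n)\<close> almost minimize
  \<open>\<E> p + \<E> n\<close>, the parallelogram law makes \<open>\<E> (p - p')\<close> small for a later pair \<open>(p', n')\<close>. As
  \<open>(p - p')\<^sup>+\<close> is dominated by \<open>p\<close>, it tends to \<open>p\<close> in \<open>L\<^sup>2\<close>, so \<open>\<E> p\<close> is small as well; likewise \<open>\<E> n\<close>.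
  The triangle inequality for \<open>\<E>\<^bsup>1/2\<^esup>\<close> gives \<open>\<E> v \<le> c\<close>.\<close>

section \<open>Quadratic forms on measurable functions\<close>

text \<open>The obstacle is that approximants converging locally in measure with bounded energy need
  not be bounded in \<open>L2\<close>, so closedness on \<open>L2\<close> cannot be applied to them,
  nor can weak compactness. The Markov property enters only through the positive part, and what it
  supplies is order in place of the missing bound: when something nonnegative is subtracted from a
  fixed \<open>p\<close> in \<open>L2\<close>, the positive part of the result stays between
  \<open>0\<close> and \<open>p\<close>, and dominated convergence becomes available. The topology
  of \<open>L0\<close> need not be metrizable, so approximation is indexed by pairs of a set of
  finite measure and a tolerance, and almost minimizers are taken relative to a supremum of infima
  over these pairs. Sequences come back only when a single function of \<open>L2\<close> singles out
  countably many sets of finite measure. The relaxation is compared with the form only on the domain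
  of the form, which is all that an extension demands.\<close>

lemma additive_bounded_linear:
  fixes h :: "real \<Rightarrow> real"
  assumes add: "\<And>a b. h (a + b) = h a + h b" and bd: "\<And>t. 0 \<le> t \<Longrightarrow> t \<le> 1 \<Longrightarrow> \<bar>h t\<bar> \<le> B"
  shows "h t = t * h 1"
proof -
  \<comment> \<open>Subtracting the expected linear map leaves an additive function that vanishes at
    the integers. It therefore has period \<open>1\<close> and is bounded, and
    \<open>k (n * t) = n * k t\<close> leaves only zero.\<close>
  define k where "k t = h t - t * h 1" for t
  have kadd: "k (a + b) = k a + k b" for a b
    by (simp add: k_def add algebra_simps)
  have k0: "k 0 = 0"
    using kadd[of 0 0] by simp
  have kneg: "k (- a) = - k a" for a
    using kadd[of a "- a"] k0 by simp
  have knat: "k (real n * t) = real n * k t" for n t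
    by (induction n) (simp_all add: k0 kadd distrib_right)
  have kint: "k (of_int j) = 0" for j
  proof (cases j)
    case (nonneg n)
    then show ?thesis using knat[of n 1] by (simp add: k_def)
  next
    case (neg n)
    then show ?thesis using knat[of "Suc n" 1] kneg[of "1 + real n"] by (simp add: k_def)
  qed
  have bound: "\<bar>k t\<bar> \<le> B + \<bar>h 1\<bar>" for t
  proof -
    have "k t = k (frac t)"
      using kadd[of "of_int \<lfloor>t\<rfloor>" "frac t"] kint by (simp add: frac_def)
    moreover have "\<bar>frac t * h 1\<bar> \<le> \<bar>h 1\<bar>"
      using frac_ge_0[of t] frac_lt_1[of t] by (simp add: abs_mult mult_left_le_one_le)
    moreover have "\<bar>h (frac t)\<bar> \<le> B"
      using bd[of "frac t"] frac_ge_0[of t] frac_lt_1[of t] by simp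
    ultimately show ?thesis
      unfolding k_def by linarith
  qed
  have "k t = 0"
  proof (rule ccontr)
    assume "k t \<noteq> 0"
    then obtain n where "B + \<bar>h 1\<bar> < real n * \<bar>k t\<bar>"
      using reals_Archimedean3[of "\<bar>k t\<bar>"] by auto
    then show False
      using bound[of "real n * t"] by (simp add: knat abs_mult)
  qed
  then show ?thesis
    by (simp add: k_def)
qed

lemma nonneg_quadratic_discrim:
  fixes a b c :: real
  assumes "0 \<le> a" and "\<And>t. 0 \<le> a * t\<^sup>2 + b * t + c"
  shows "b\<^sup>2 \<le> 4 * a * c"
proof (cases "a = 0")
  case True
  \<comment> \<open>Otherwise the affine function would take the value \<open>-1\<close> at
    \<open>- (c + 1) / b\<close>.\<close>
  have "b = 0"
  proof (rule ccontr)
    assume "b \<noteq> 0"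
    then show False
      using assms(2)[of "- (c + 1) / b"] True by simp
  qed
  then show ?thesis
    using True by simp
next
  case False
  then show ?thesis
    using assms(1) assms(2)[of "- b / (2 * a)"] by (simp add: power2_eq_square field_simps)
qed

text \<open>The parallelogram law along the line \<open>t \<mapsto> u + t v\<close>, with \<open>P t = q (u + t v)\<close> and
  \<open>c = q v\<close>, makes \<open>P\<close> a nonnegative quadratic polynomial (Jordan and von Neumann).\<close>

lemma parallelogram_triangle:
  fixes P :: "real \<Rightarrow> real"
  assumes c: "0 \<le> c" and nonneg: "\<And>t. 0 \<le> P t"
    and para: "\<And>t s. P (t + s) + P (t - s) = 2 * P t + 2 * (s\<^sup>2 * c)"
  shows "sqrt (P 1) \<le> sqrt (P 0) + sqrt c"
proof -
  \<comment> \<open>For a form given by an inner product this is \<open>t\<close> times twice the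
    inner product of \<open>u\<close> and \<open>v\<close>. Midpoint affinity together with
    \<open>h 0 = 0\<close> makes it additive.\<close>
  define h where "h t = P t - t\<^sup>2 * c - P 0" for t
  have h2: "h (t + s) + h (t - s) = 2 * h t" for t s
    using para[of t s] by (simp add: h_def power2_eq_square algebra_simps)
  have h0: "h 0 = 0"
    by (simp add: h_def)
  have "h (a + b) = h a + h b" for a b
  proof -
    have "h a + h b = 2 * h ((a + b) / 2)"
      using h2[of "(a + b) / 2" "(a - b) / 2"] by (simp add: field_simps)
    also have "\<dots> = h (a + b)"
      using h2[of "(a + b) / 2" "(a + b) / 2"] h0 by (simp add: field_sum_of_halves del: add_divide_distrib)
    finally show ?thesis by simp
  qed
  \<comment> \<open>No continuity of \<open>P\<close> is assumed; the parallelogram law centred at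
    \<open>0\<close> gives the local bound that excludes wild additive functions.\<close>
  moreover have "\<bar>h t\<bar> \<le> P 0 + 2 * c" if "0 \<le> t" "t \<le> 1" for t
  proof -
    have "P t \<le> 2 * P 0 + 2 * (t\<^sup>2 * c)"
      using para[of 0 t] nonneg[of "- t"] by simp
    moreover have "t\<^sup>2 * c \<le> c" "0 \<le> t\<^sup>2 * c"
      using that c by (simp_all add: mult_left_le_one_le power_le_one)
    ultimately show ?thesis
      using nonneg[of t] nonneg[of 0] c unfolding h_def by linarith
  qed
  ultimately have lin: "h t = t * h 1" for t
    by (rule additive_bounded_linear)
  have P: "P t = c * t\<^sup>2 + h 1 * t + P 0" for t
    using lin[of t] by (simp add: h_def algebra_simps)
  \<comment> \<open>This is the Cauchy-Schwarz inequality, as \<open>h 1\<close> is twice the inner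
    product.\<close>
  have "(h 1)\<^sup>2 \<le> 4 * c * P 0"
    using c nonneg P by (intro nonneg_quadratic_discrim) metis+
  then have "\<bar>h 1\<bar> \<le> sqrt (4 * c * P 0)"
    using real_le_rsqrt by (metis power2_abs)
  then have "h 1 \<le> 2 * (sqrt (P 0) * sqrt c)"
    by (simp add: real_sqrt_mult mult_ac)
  then have "P 1 \<le> (sqrt (P 0) + sqrt c)\<^sup>2"
    using P[of 1] c nonneg[of 0] by (simp add: power2_sum)
  then show ?thesis
    by (intro real_le_lsqrt) (use c nonneg in auto)
qed

text \<open>Forms are handled on functions, with invariance under a.e. equality as an axiom. The
  same Hilbert space arguments then serve three forms: the Dirichlet form, its relaxation and the
  squared \<open>L2\<close> norm.\<close>

locale L0_form =
  fixes M :: "'a measure" and Q :: "('a \<Rightarrow> real) \<Rightarrow> ennreal"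
  assumes cong: "\<And>f g. f \<in> borel_measurable M \<Longrightarrow> g \<in> borel_measurable M \<Longrightarrow>
      AE x in M. f x = g x \<Longrightarrow> Q f = Q g"
    and para: "\<And>f g. f \<in> borel_measurable M \<Longrightarrow> g \<in> borel_measurable M \<Longrightarrow>
      2 * Q f + 2 * Q g = Q (\<lambda>x. f x + g x) + Q (\<lambda>x. f x - g x)"
    and scale: "\<And>c f. f \<in> borel_measurable M \<Longrightarrow> Q (\<lambda>x. c * f x) = ennreal (c\<^sup>2) * Q f"
begin

definition dom :: "('a \<Rightarrow> real) set" where
  "dom = {f \<in> borel_measurable M. Q f < \<infinity>}"

text \<open>Real values are needed because the midpoint identity subtracts. Off \<open>dom\<close>
  the value is the default \<open>0\<close> and carries no information.\<close>

definition q :: "('a \<Rightarrow> real) \<Rightarrow> real" where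
  "q f = enn2real (Q f)"

lemma dom_measurable: "f \<in> dom \<Longrightarrow> f \<in> borel_measurable M"
  by (simp add: dom_def)

lemma q_nonneg [simp]: "0 \<le> q f"
  by (simp add: q_def)

lemma Q_eq_q: "f \<in> dom \<Longrightarrow> Q f = ennreal (q f)"
  by (simp add: q_def dom_def)

lemma dom_le: "f \<in> borel_measurable M \<Longrightarrow> Q f \<le> ennreal c \<Longrightarrow> f \<in> dom"
  by (auto simp: dom_def intro: le_less_trans)

lemma q_le: "0 \<le> c \<Longrightarrow> Q f \<le> ennreal c \<Longrightarrow> q f \<le> c"
  unfolding q_def by (rule enn2real_leI)

lemma Q_zero: "Q (\<lambda>x. 0) = 0"
  using scale[of "\<lambda>x. 0" 0] by simp

lemma dom_zero: "(\<lambda>x. 0) \<in> dom"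
  by (simp add: dom_def Q_zero)

lemma q_zero [simp]: "q (\<lambda>x. 0) = 0"
  by (simp add: q_def Q_zero)

lemma dom_add_diff:
  assumes "f \<in> dom" "g \<in> dom"
  shows "(\<lambda>x. f x + g x) \<in> dom" "(\<lambda>x. f x - g x) \<in> dom"
proof -
  have [measurable]: "f \<in> borel_measurable M" "g \<in> borel_measurable M"
    using assms by (auto simp: dom_def)
  have "Q (\<lambda>x. f x + g x) + Q (\<lambda>x. f x - g x) < \<infinity>"
    using assms para[of f g] by (simp add: dom_def ennreal_mult_less_top flip: para)
  then show "(\<lambda>x. f x + g x) \<in> dom" "(\<lambda>x. f x - g x) \<in> dom"
    by (simp_all add: dom_def)
qed

lemma dom_scale: "f \<in> dom \<Longrightarrow> (\<lambda>x. c * f x) \<in> dom"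
  by (auto simp: dom_def scale ennreal_mult_less_top)

lemma q_scale: "f \<in> dom \<Longrightarrow> q (\<lambda>x. c * f x) = c\<^sup>2 * q f"
  by (simp add: q_def scale dom_measurable enn2real_mult)

lemma q_para:
  assumes "f \<in> dom" "g \<in> dom"
  shows "q (\<lambda>x. f x + g x) + q (\<lambda>x. f x - g x) = 2 * q f + 2 * q g"
proof -
  have "ennreal (q (\<lambda>x. f x + g x) + q (\<lambda>x. f x - g x)) = ennreal (2 * q f + 2 * q g)"
    using para[OF assms[THEN dom_measurable]] assms dom_add_diff[OF assms]
    by (simp add: Q_eq_q ennreal_plus ennreal_mult del: ennreal_plus[symmetric])
  then show ?thesis
    by (subst (asm) ennreal_inj) simp_all
qed

lemma q_minus_commute:
  assumes "f \<in> dom" "g \<in> dom"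
  shows "q (\<lambda>x. f x - g x) = q (\<lambda>x. g x - f x)"
  using q_scale[OF dom_add_diff(2)[OF assms], of "-1"] by simp

text \<open>The parallelogram law solved for the difference. If two elements almost minimize
  \<open>q\<close> on a set that contains their midpoint, their difference has small energy; this
  replaces weak compactness throughout.\<close>

lemma q_mid:
  assumes "f \<in> dom" "g \<in> dom"
  shows "q (\<lambda>x. f x - g x) = 2 * q f + 2 * q g - 4 * q (\<lambda>x. (f x + g x) / 2)"
    and "(\<lambda>x. (f x + g x) / 2) \<in> dom"
proof -
  have "q (\<lambda>x. 1 / 2 * (f x + g x)) = (1 / 2)\<^sup>2 * q (\<lambda>x. f x + g x)"
    by (rule q_scale[OF dom_add_diff(1)[OF assms]])
  then show "q (\<lambda>x. f x - g x) = 2 * q f + 2 * q g - 4 * q (\<lambda>x. (f x + g x) / 2)"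
    using q_para[OF assms] by (simp add: power2_eq_square)
  show "(\<lambda>x. (f x + g x) / 2) \<in> dom"
    using dom_scale[OF dom_add_diff(1)[OF assms], of "1 / 2"] by simp
qed

lemma q_mid_le:
  assumes "f \<in> dom" "g \<in> dom" "q f \<le> c" "q g \<le> c"
  shows "q (\<lambda>x. (f x + g x) / 2) \<le> c"
  using q_mid(1)[OF assms(1,2)] q_nonneg[of "\<lambda>x. f x - g x"] assms(3,4) by linarith

lemma sqrt_q_triangle:
  assumes f: "f \<in> dom" and g: "g \<in> dom"
  shows "sqrt (q (\<lambda>x. f x + g x)) \<le> sqrt (q f) + sqrt (q g)"
proof -
  define P where "P t = q (\<lambda>x. f x + t * g x)" for t
  have "P (t + s) + P (t - s) = 2 * P t + 2 * (s\<^sup>2 * q g)" for t s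
    using q_para[OF dom_add_diff(1)[OF f dom_scale[OF g, of t]] dom_scale[OF g, of s]]
    by (simp add: P_def q_scale g algebra_simps)
  then have "sqrt (P 1) \<le> sqrt (P 0) + sqrt (q g)"
    by (intro parallelogram_triangle) (simp_all add: P_def)
  then show ?thesis
    by (simp add: P_def)
qed

lemma sqrt_q_triangle_diff:
  assumes "f \<in> dom" "g \<in> dom" "h \<in> dom"
  shows "sqrt (q (\<lambda>x. f x - g x)) \<le> sqrt (q (\<lambda>x. f x - h x)) + sqrt (q (\<lambda>x. h x - g x))"
  using sqrt_q_triangle[OF dom_add_diff(2)[OF assms(1,3)] dom_add_diff(2)[OF assms(3,2)]] by simp

end

text \<open>Treating the squared norm as a form yields linearity of \<open>L2\<close> (as
  \<open>sq.dom\<close>) and Minkowski's inequality as instances of the general lemmas.\<close>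

lemma L0_form_square: "L0_form M (\<lambda>f. \<integral>\<^sup>+x. ennreal ((f x)\<^sup>2) \<partial>M)"
proof
  fix f g :: "'a \<Rightarrow> real"
  assume [measurable]: "f \<in> borel_measurable M" "g \<in> borel_measurable M"
  show "(\<integral>\<^sup>+x. ennreal ((f x)\<^sup>2) \<partial>M) = (\<integral>\<^sup>+x. ennreal ((g x)\<^sup>2) \<partial>M)" if "AE x in M. f x = g x"
    using that by (intro nn_integral_cong_AE) auto
  have "2 * (\<integral>\<^sup>+x. ennreal ((f x)\<^sup>2) \<partial>M) + 2 * (\<integral>\<^sup>+x. ennreal ((g x)\<^sup>2) \<partial>M) =
      (\<integral>\<^sup>+x. 2 * ennreal ((f x)\<^sup>2) + 2 * ennreal ((g x)\<^sup>2) \<partial>M)"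
    by (simp add: nn_integral_add nn_integral_cmult)
  also have "\<dots> = (\<integral>\<^sup>+x. ennreal ((f x + g x)\<^sup>2) + ennreal ((f x - g x)\<^sup>2) \<partial>M)"
  proof (rule nn_integral_cong)
    fix x
    have "2 * ennreal ((f x)\<^sup>2) + 2 * ennreal ((g x)\<^sup>2) = ennreal (2 * (f x)\<^sup>2 + 2 * (g x)\<^sup>2)"
      by (simp add: ennreal_plus ennreal_mult del: ennreal_plus[symmetric])
    also have "2 * (f x)\<^sup>2 + 2 * (g x)\<^sup>2 = (f x + g x)\<^sup>2 + (f x - g x)\<^sup>2"
      by (simp add: power2_eq_square algebra_simps)
    finally show "2 * ennreal ((f x)\<^sup>2) + 2 * ennreal ((g x)\<^sup>2) =
        ennreal ((f x + g x)\<^sup>2) + ennreal ((f x - g x)\<^sup>2)"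
      by simp
  qed
  also have "\<dots> = (\<integral>\<^sup>+x. ennreal ((f x + g x)\<^sup>2) \<partial>M) + (\<integral>\<^sup>+x. ennreal ((f x - g x)\<^sup>2) \<partial>M)"
    by (rule nn_integral_add) auto
  finally show "2 * (\<integral>\<^sup>+x. ennreal ((f x)\<^sup>2) \<partial>M) + 2 * (\<integral>\<^sup>+x. ennreal ((g x)\<^sup>2) \<partial>M) =
      (\<integral>\<^sup>+x. ennreal ((f x + g x)\<^sup>2) \<partial>M) + (\<integral>\<^sup>+x. ennreal ((f x - g x)\<^sup>2) \<partial>M)" .
next
  fix c and f :: "'a \<Rightarrow> real"
  assume [measurable]: "f \<in> borel_measurable M"
  show "(\<integral>\<^sup>+x. ennreal ((c * f x)\<^sup>2) \<partial>M) = ennreal (c\<^sup>2) * (\<integral>\<^sup>+x. ennreal ((f x)\<^sup>2) \<partial>M)"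
    by (simp add: power_mult_distrib ennreal_mult nn_integral_cmult)
qed

interpretation sq: L0_form M "\<lambda>f. \<integral>\<^sup>+x. ennreal ((f x)\<^sup>2) \<partial>M" for M :: "'a measure"
  by (rule L0_form_square)

lemma sq_dom_iff: "f \<in> sq.dom M \<longleftrightarrow> f \<in> borel_measurable M \<and> integrable M (\<lambda>x. (f x)\<^sup>2)"
  by (auto simp: sq.dom_def integrable_iff_bounded)

lemma sq_q_eq:
  assumes "f \<in> borel_measurable M"
  shows "sq.q M f = (LINT x|M. (f x)\<^sup>2)"
  unfolding sq.q_def using assms by (subst integral_eq_nn_integral) auto

text \<open>\<open>m\<close> is the supremum over the family of the infima of \<open>q\<close>.\<close>

lemma sup_inf_obtain:
  fixes q :: "'b \<Rightarrow> real" and R :: "'i \<Rightarrow> 'b set"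
  assumes I: "I \<noteq> {}" and nonneg: "\<And>x. 0 \<le> q x" and bd: "\<And>i. i \<in> I \<Longrightarrow> \<exists>x\<in>R i. q x \<le> K"
  obtains m where "\<And>i \<tau>. i \<in> I \<Longrightarrow> 0 < \<tau> \<Longrightarrow> \<exists>x\<in>R i. q x < m + \<tau>"
    and "\<And>\<tau>. 0 < \<tau> \<Longrightarrow> \<exists>i\<in>I. \<forall>x\<in>R i. m - \<tau> < q x"
proof
  let ?C = "{c. \<exists>i\<in>I. \<forall>x\<in>R i. c \<le> q x}"
  have ne: "?C \<noteq> {}"
    using I nonneg by blast
  have bdd: "bdd_above ?C"
  proof (rule bdd_aboveI)
    fix c assume "c \<in> ?C"
    then obtain i where "i \<in> I" "\<And>x. x \<in> R i \<Longrightarrow> c \<le> q x"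
      by blast
    then show "c \<le> K"
      using bd by (meson order_trans)
  qed
  show "\<exists>x\<in>R i. q x < Sup ?C + \<tau>" if "i \<in> I" "0 < \<tau>" for i \<tau>
  proof (rule ccontr)
    assume "\<not> ?thesis"
    then have "Sup ?C + \<tau> \<in> ?C"
      using that by (auto simp: not_less)
    then show False
      using cSup_upper[OF _ bdd] that(2) by force
  qed
  show "\<exists>i\<in>I. \<forall>x\<in>R i. Sup ?C - \<tau> < q x" if "0 < \<tau>" for \<tau>
  proof -
    have "Sup ?C - \<tau> < Sup ?C"
      using that by simp
    then obtain c where c: "c \<in> ?C" "Sup ?C - \<tau> < c"
      unfolding less_cSup_iff[OF ne bdd] by blast
    then obtain i where "i \<in> I" "\<And>x. x \<in> R i \<Longrightarrow> c \<le> q x"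
      by blast
    with c(2) show ?thesis
      by (meson less_le_trans)
  qed
qed

section \<open>Local convergence in measure and the form topology\<close>

definition ldist :: "'a measure \<Rightarrow> 'a set \<Rightarrow> ('a \<Rightarrow> real) \<Rightarrow> ('a \<Rightarrow> real) \<Rightarrow> real" where
  "ldist M U f g = (LINT x:U|M. min \<bar>f x - g x\<bar> 1)"

lemma ldist_integrable:
  assumes "U \<in> fmeasurable M" and [measurable]: "f \<in> borel_measurable M" "g \<in> borel_measurable M"
  shows "set_integrable M U (\<lambda>x. min \<bar>f x - g x\<bar> (1::real))"
proof -
  have [measurable]: "U \<in> sets M"
    using assms(1) by auto
  show ?thesis
    unfolding set_integrable_def
    by (rule integrableI_bounded_set_indicator[where B = 1]) (use assms(1) in \<open>auto simp: fmeasurable_def\<close>)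
qed

lemma ldist_nonneg [simp]: "0 \<le> ldist M U f g"
  unfolding ldist_def set_lebesgue_integral_def by (rule integral_nonneg_AE) auto

lemma ldist_refl [simp]: "ldist M U f f = 0"
  by (simp add: ldist_def set_lebesgue_integral_def)

lemma ldist_commute: "ldist M U f g = ldist M U g f"
  by (simp add: ldist_def abs_minus_commute)

lemma ldist_cong_AE:
  assumes "U \<in> sets M" and [measurable]: "f \<in> borel_measurable M" "g \<in> borel_measurable M"
      "f' \<in> borel_measurable M" "g' \<in> borel_measurable M"
    and ae: "AE x in M. x \<in> U \<longrightarrow> f x = f' x" "AE x in M. x \<in> U \<longrightarrow> g x = g' x"
  shows "ldist M U f g = ldist M U f' g'"
  unfolding ldist_def set_lebesgue_integral_def
proof (rule integral_cong_AE)
  show "AE x in M. indicat_real U x *\<^sub>R min \<bar>f x - g x\<bar> 1 = indicat_real U x *\<^sub>R min \<bar>f' x - g' x\<bar> 1"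
    using ae by eventually_elim (simp add: indicator_def)
qed (use assms(1) in measurable)

text \<open>A single pointwise comparison of truncated distances is the common source of the
  triangle inequality, of domination, and of the estimates for sums, differences and
  midpoints.\<close>

lemma ldist_le_add:
  assumes U: "U \<in> fmeasurable M"
    and meas: "f \<in> borel_measurable M" "g \<in> borel_measurable M" "a \<in> borel_measurable M"
      "b \<in> borel_measurable M" "c \<in> borel_measurable M" "d \<in> borel_measurable M"
    and le: "\<And>x. min \<bar>f x - g x\<bar> 1 \<le> min \<bar>a x - b x\<bar> 1 + min \<bar>c x - d x\<bar> 1"
  shows "ldist M U f g \<le> ldist M U a b + ldist M U c d"
proof -
  note i = ldist_integrable[OF U]
  have "ldist M U a b + ldist M U c d = (LINT x:U|M. min \<bar>a x - b x\<bar> 1 + min \<bar>c x - d x\<bar> 1)"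
    unfolding ldist_def by (rule set_integral_add(2)[symmetric]; intro i meas)
  moreover have "ldist M U f g \<le> (LINT x:U|M. min \<bar>a x - b x\<bar> 1 + min \<bar>c x - d x\<bar> 1)"
    unfolding ldist_def using le
    by (intro set_integral_mono set_integral_add(1) i meas)
  ultimately show ?thesis
    by simp
qed

lemma ldist_le:
  assumes "U \<in> fmeasurable M"
    and "f \<in> borel_measurable M" "g \<in> borel_measurable M" "a \<in> borel_measurable M"
      "b \<in> borel_measurable M"
    and "\<And>x. \<bar>f x - g x\<bar> \<le> \<bar>a x - b x\<bar>"
  shows "ldist M U f g \<le> ldist M U a b"
  using ldist_le_add[OF assms(1-5), of a a] assms(4,6) by (simp add: min.coboundedI1 min_le_iff_disj)

lemma ldist_triangle:
  assumes "U \<in> fmeasurable M"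
    and "f \<in> borel_measurable M" "g \<in> borel_measurable M" "h \<in> borel_measurable M"
  shows "ldist M U f g \<le> ldist M U f h + ldist M U h g"
  by (rule ldist_le_add) (use assms in \<open>auto simp: min_def\<close>)

lemma ldist_mono_set:
  assumes "V \<in> fmeasurable M" "U \<in> sets M" "U \<subseteq> V"
    and "f \<in> borel_measurable M" "g \<in> borel_measurable M"
  shows "ldist M U f g \<le> ldist M V f g"
proof -
  have U: "U \<in> fmeasurable M"
    using assms by (meson fmeasurableI2)
  show ?thesis
    unfolding ldist_def set_lebesgue_integral_def
    by (intro integral_mono ldist_integrable[unfolded set_integrable_def] U assms(1,4,5))
       (use assms(3) in \<open>auto simp: indicator_def\<close>)
qed

text \<open>Truncation at \<open>1\<close> destroys homogeneity. The factor
  \<open>max 1 \<bar>c\<bar>\<close> works both where the truncation is active and where it is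
  not.\<close>

lemma ldist_scale_le:
  assumes U: "U \<in> fmeasurable M" and [measurable]: "f \<in> borel_measurable M" "g \<in> borel_measurable M"
  shows "ldist M U (\<lambda>x. c * f x) (\<lambda>x. c * g x) \<le> max 1 \<bar>c\<bar> * ldist M U f g"
proof -
  have "min \<bar>c * f x - c * g x\<bar> 1 \<le> max 1 \<bar>c\<bar> * min \<bar>f x - g x\<bar> 1" for x
  proof -
    have "\<bar>c * f x - c * g x\<bar> = \<bar>c\<bar> * \<bar>f x - g x\<bar>"
      by (simp add: abs_mult flip: right_diff_distrib)
    moreover have "\<bar>c\<bar> * \<bar>f x - g x\<bar> \<le> max 1 \<bar>c\<bar> * \<bar>f x - g x\<bar>"
      by (intro mult_right_mono) auto
    ultimately have "min \<bar>c * f x - c * g x\<bar> 1 \<le> max 1 \<bar>c\<bar> * \<bar>f x - g x\<bar>"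
      by linarith
    moreover have "min \<bar>c * f x - c * g x\<bar> 1 \<le> max 1 \<bar>c\<bar> * 1"
      by linarith
    ultimately show ?thesis
      by (cases "\<bar>f x - g x\<bar> \<le> 1") (simp_all only: min_absorb1 min_absorb2 not_le less_imp_le)
  qed
  then have "ldist M U (\<lambda>x. c * f x) (\<lambda>x. c * g x) \<le> (LINT x:U|M. max 1 \<bar>c\<bar> * min \<bar>f x - g x\<bar> 1)"
    unfolding ldist_def by (intro set_integral_mono set_integrable_mult_right impI ldist_integrable U) auto
  then show ?thesis
    by (simp add: ldist_def)
qed

section \<open>Passing between classes and representatives; limits in the generated
  topologies\<close>

lemma rep_measurable: "u \<in> L0_classes M \<Longrightarrow> rep u \<in> borel_measurable M"
  by (elim L0_classesE) (simp add: rep_ae_class)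

lemma ae_class_rep:
  assumes "u \<in> L0_classes M"
  shows "ae_class M (rep u) = u"
proof -
  obtain f where f: "f \<in> borel_measurable M" "u = ae_class M f"
    using assms by (rule L0_classesE)
  then show ?thesis
    using rep_ae_class[OF f(1)] by (simp add: ae_class_eq_iff)
qed

lemma vdiff_ae_class:
  assumes [measurable]: "f \<in> borel_measurable M" "g \<in> borel_measurable M"
  shows "vdiff (L0_space M) (ae_class M f) (ae_class M g) = ae_class M (\<lambda>x. f x - g x)"
  by (simp add: vdiff_def vscale_ae_class vadd_ae_class)

lemma local_dist_eq_ldist: "local_dist M U u v = ldist M U (rep u) (rep v)"
  by (simp add: local_dist_def ldist_def)

lemma vcarrier_L0_space: "vcarrier (L0_space M) = L0_classes M"
  by (simp add: L0_space_def)

lemma L2_space_simps: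
  "vcarrier (L2_space M) = L2_classes M"
  "vtop (L2_space M) = pseudometric_topology (L2_classes M) {L2_dist M}"
  "vadd (L2_space M) = vadd (L0_space M)" "vscale (L2_space M) = vscale (L0_space M)"
  "vdiff (L2_space M) = vdiff (L0_space M)" "vzero (L2_space M) = vzero (L0_space M)"
  by (simp_all add: L2_space_def vdiff_def fun_eq_iff)

lemma topspace_pseudometric_topology:
  assumes "\<D> \<noteq> {}" "\<And>d u. d \<in> \<D> \<Longrightarrow> u \<in> S \<Longrightarrow> d u u = 0"
  shows "topspace (pseudometric_topology S \<D>) = S"
proof
  show "S \<subseteq> topspace (pseudometric_topology S \<D>)"
  proof
    fix u assume u: "u \<in> S"
    obtain d where d: "d \<in> \<D>"
      using assms(1) by blast
    have "u \<in> {v \<in> S. d u v < 1}"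
      using u assms(2)[OF d u] by simp
    then show "u \<in> topspace (pseudometric_topology S \<D>)"
      unfolding pseudometric_topology_def topology_generated_by_topspace
      using d u zero_less_one by blast
  qed
qed (auto simp: pseudometric_topology_def topology_generated_by_topspace)

text \<open>Convergence can be tested on a subbase, and here the subbase is the union of the two
  topologies. Equality of the underlying spaces keeps the points of the join the same as those of
  each topology.\<close>

lemma limitin_generated_by_Un:
  assumes eq: "topspace X = topspace Y"
  shows "limitin (topology_generated_by ({W. openin X W} \<union> {W. openin Y W})) f l F \<longleftrightarrow>
    limitin X f l F \<and> limitin Y f l F" (is "limitin ?T f l F \<longleftrightarrow> _")
proof
  have op: "openin ?T W" if "openin X W \<or> openin Y W" for W
    using that by (intro topology_generated_by_Basis) auto
  have ts: "topspace ?T = topspace X"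
  proof
    show "topspace ?T \<subseteq> topspace X"
      unfolding topology_generated_by_topspace using eq openin_subset by fast
    show "topspace X \<subseteq> topspace ?T"
      using op[of "topspace X"] openin_subset by blast
  qed
  show "limitin X f l F \<and> limitin Y f l F" if "limitin ?T f l F"
    using that op ts eq by (auto simp: limitin_def)
  assume l: "limitin X f l F \<and> limitin Y f l F"
  have "\<forall>\<^sub>F i in F. f i \<in> W" if "openin ?T W" "l \<in> W" for W
  proof -
    have "generate_topology_on ({W. openin X W} \<union> {W. openin Y W}) W"
      using that(1) by (rule openin_topology_generated_by)
    then show ?thesis
      using that(2)
    proof induction
      case (Int a b)
      then show ?case
        by (auto intro: eventually_conj)
    next
      case (UN K)
      then obtain k where "k \<in> K" "l \<in> k" "\<forall>\<^sub>F i in F. f i \<in> k"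
        by blast
      then show ?case
        by (auto elim!: eventually_mono)
    next
      case (Basis s)
      then show ?case
        using l by (auto simp: limitin_def)
    qed simp
  qed
  then show "limitin ?T f l F"
    using l ts by (auto simp: limitin_def)
qed

lemma topspace_vtop_L0_space: "topspace (vtop (L0_space M)) = L0_classes M"
  unfolding L0_space_def tvs.simps
  by (rule topspace_pseudometric_topology)
     (auto simp: local_dist_eq_ldist intro!: exI[of _ "{}"])

lemma fmeasurable_iff: "U \<in> fmeasurable M \<longleftrightarrow> U \<in> sets M \<and> emeasure M U < \<infinity>"
  by (simp add: fmeasurable_def)

text \<open>In contrast to \<open>limitin_L0_space\<close>, measurability is demanded only
  eventually: \<open>w\<close> will be \<open>rep\<close> along filters that lie in the form domain
  only eventually.\<close>

lemma limitin_vtop_L0_space: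
  assumes f: "f \<in> borel_measurable M" and w: "\<forall>\<^sub>F i in F. w i \<in> borel_measurable M"
  shows "limitin (vtop (L0_space M)) (\<lambda>i. ae_class M (w i)) (ae_class M f) F \<longleftrightarrow>
    (\<forall>U\<in>fmeasurable M. \<forall>r>0. \<forall>\<^sub>F i in F. ldist M U f (w i) < r)"
proof -
  let ?D = "{local_dist M U | U. U \<in> sets M \<and> emeasure M U < \<infinity>}"
  have eq: "local_dist M U (ae_class M f) (ae_class M g) = ldist M U f g"
    if "U \<in> sets M" "g \<in> borel_measurable M" for U g
    unfolding ldist_def by (rule local_dist_ae_class[OF f that(2,1)])
  have "limitin (vtop (L0_space M)) (\<lambda>i. ae_class M (w i)) (ae_class M f) F \<longleftrightarrow>
      (\<forall>d\<in>?D. \<forall>r>0. \<forall>\<^sub>F i in F. d (ae_class M f) (ae_class M (w i)) < r)"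
    unfolding L0_space_def tvs.simps
  proof (rule limitin_pseudometric_topology)
    show "?D \<noteq> {}"
      using sets.empty_sets[of M] emeasure_empty[of M] by fastforce
    show "d u v \<le> d u (ae_class M f) + d (ae_class M f) v"
      if "d \<in> ?D" "u \<in> L0_classes M" "v \<in> L0_classes M" for d u v
      using that f
      by (auto simp: local_dist_eq_ldist fmeasurable_iff ae_class_in_L0 intro!: ldist_triangle rep_measurable)
    show "\<forall>\<^sub>F i in F. ae_class M (w i) \<in> L0_classes M"
      using w by eventually_elim (rule ae_class_in_L0)
  qed (auto simp: ae_class_in_L0 f local_dist_eq_ldist)
  also have "\<dots> \<longleftrightarrow> (\<forall>U\<in>fmeasurable M. \<forall>r>0.
      \<forall>\<^sub>F i in F. local_dist M U (ae_class M f) (ae_class M (w i)) < r)"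
  proof -
    have "?D = local_dist M ` fmeasurable M"
      by (auto simp: fmeasurable_iff)
    then show ?thesis
      by simp
  qed
  also have "\<dots> \<longleftrightarrow> (\<forall>U\<in>fmeasurable M. \<forall>r>0. \<forall>\<^sub>F i in F. ldist M U f (w i) < r)"
  proof -
    have "(\<forall>\<^sub>F i in F. local_dist M U (ae_class M f) (ae_class M (w i)) < r) \<longleftrightarrow>
        (\<forall>\<^sub>F i in F. ldist M U f (w i) < r)" if "U \<in> fmeasurable M" for U r
      by (rule eventually_subst, use w in eventually_elim) (use that in \<open>simp add: eq fmeasurable_iff\<close>)
    then show ?thesis
      by simp
  qed
  finally show ?thesis .
qed

text \<open>The bridge from forms on classes to \<open>L0_form\<close>. Reading a form on
  representatives turns convergence in its form topology into conditions on \<open>ldist\<close> and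
  \<open>q\<close>.\<close>

locale L0_class_form =
  fixes M :: "'a measure" and E :: "('a \<Rightarrow> real) set \<Rightarrow> ennreal"
  assumes quadratic: "quadratic_form (L0_space M) E"
begin

sublocale L0_form M "\<lambda>f. E (ae_class M f)"
proof
  fix f g :: "'a \<Rightarrow> real"
  assume f: "f \<in> borel_measurable M" "g \<in> borel_measurable M"
  show "E (ae_class M f) = E (ae_class M g)" if "AE x in M. f x = g x"
    using ae_class_eq_iff[OF f] that by simp
  note V = f[THEN ae_class_in_L0]
  have "2 * E (ae_class M f) + 2 * E (ae_class M g) =
      E (vadd (L0_space M) (ae_class M f) (ae_class M g)) +
      E (vdiff (L0_space M) (ae_class M f) (ae_class M g))"
    using quadratic V unfolding quadratic_form_def vcarrier_L0_space by blast
  then show "2 * E (ae_class M f) + 2 * E (ae_class M g) =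
      E (ae_class M (\<lambda>x. f x + g x)) + E (ae_class M (\<lambda>x. f x - g x))"
    by (simp only: vadd_ae_class[OF f] vdiff_ae_class[OF f])
  have "E (vscale (L0_space M) c (ae_class M f)) = ennreal (\<bar>c\<bar>\<^sup>2) * E (ae_class M f)" for c
    using quadratic V unfolding quadratic_form_def vcarrier_L0_space by blast
  then show "E (ae_class M (\<lambda>x. c * f x)) = ennreal (c\<^sup>2) * E (ae_class M f)" for c
    by (simp only: vscale_ae_class[OF f(1)] power2_abs)
qed

lemma form_domain_iff:
  assumes "f \<in> borel_measurable M"
  shows "ae_class M f \<in> form_domain (L0_space M) E \<longleftrightarrow> f \<in> dom"
  using assms by (simp add: form_domain_def dom_def vcarrier_L0_space ae_class_in_L0)

lemma rep_in_dom: "u \<in> form_domain (L0_space M) E \<Longrightarrow> rep u \<in> dom"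
  by (auto simp: form_domain_def vcarrier_L0_space dom_def rep_measurable ae_class_rep)

lemma form_seminorm_vdiff:
  assumes "f \<in> dom" "g \<in> dom"
  shows "form_seminorm E (vdiff (L0_space M) (ae_class M f) (ae_class M g)) = sqrt (q (\<lambda>x. f x - g x))"
  using assms by (simp add: form_seminorm_def q_def vdiff_ae_class dom_measurable)

lemma form_seminorm_vdiff_rep:
  assumes "u \<in> form_domain (L0_space M) E" "v \<in> form_domain (L0_space M) E"
  shows "form_seminorm E (vdiff (L0_space M) u v) = sqrt (q (\<lambda>x. rep u x - rep v x))"
  using form_seminorm_vdiff[OF assms[THEN rep_in_dom]] assms
  by (simp add: ae_class_rep form_domain_def vcarrier_L0_space)

lemma topspace_seminorm_topology:
  "topspace (seminorm_topology (L0_space M) E) = form_domain (L0_space M) E"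
  unfolding seminorm_topology_def
  by (rule topspace_pseudometric_topology) (auto simp: form_seminorm_vdiff_rep)

lemma limitin_seminorm_topology:
  assumes f: "f \<in> dom" and w: "\<forall>\<^sub>F i in F. w i \<in> dom"
  shows "limitin (seminorm_topology (L0_space M) E) (\<lambda>i. ae_class M (w i)) (ae_class M f) F \<longleftrightarrow>
    (\<forall>r>0. \<forall>\<^sub>F i in F. sqrt (q (\<lambda>x. f x - w i x)) < r)"
proof -
  let ?d = "\<lambda>u v. form_seminorm E (vdiff (L0_space M) u v)"
  have fD: "ae_class M f \<in> form_domain (L0_space M) E"
    using f by (simp add: form_domain_iff dom_measurable)
  have "limitin (seminorm_topology (L0_space M) E) (\<lambda>i. ae_class M (w i)) (ae_class M f) F \<longleftrightarrow>
      (\<forall>d\<in>{?d}. \<forall>r>0. \<forall>\<^sub>F i in F. d (ae_class M f) (ae_class M (w i)) < r)"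
    unfolding seminorm_topology_def
  proof (rule limitin_pseudometric_topology)
    show "\<forall>\<^sub>F i in F. ae_class M (w i) \<in> form_domain (L0_space M) E"
      using w by eventually_elim (simp add: form_domain_iff dom_measurable)
    show "d u v \<le> d u (ae_class M f) + d (ae_class M f) v"
      if "d \<in> {?d}" "u \<in> form_domain (L0_space M) E" "v \<in> form_domain (L0_space M) E" for d u v
      using that fD sqrt_q_triangle_diff[OF that(2,3)[THEN rep_in_dom] rep_in_dom[OF fD]]
      by (simp add: form_seminorm_vdiff_rep)
  qed (use f fD in \<open>auto simp: form_seminorm_vdiff_rep\<close>)
  also have "\<dots> \<longleftrightarrow> (\<forall>r>0. \<forall>\<^sub>F i in F. sqrt (q (\<lambda>x. f x - w i x)) < r)"
  proof -
    have "(\<forall>\<^sub>F i in F. ?d (ae_class M f) (ae_class M (w i)) < r) \<longleftrightarrow>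
        (\<forall>\<^sub>F i in F. sqrt (q (\<lambda>x. f x - w i x)) < r)" for r
      by (rule eventually_subst, use w in eventually_elim) (simp add: form_seminorm_vdiff f)
    then show ?thesis
      by simp
  qed
  finally show ?thesis .
qed

lemma topspace_form_topology:
  "topspace (form_topology (L0_space M) E) = form_domain (L0_space M) E"
proof -
  have "openin (seminorm_topology (L0_space M) E) (form_domain (L0_space M) E)"
    using openin_topspace[of "seminorm_topology (L0_space M) E"] by (simp add: topspace_seminorm_topology)
  then show ?thesis
    unfolding form_topology_def topology_generated_by_topspace
    using openin_subset[of "seminorm_topology (L0_space M) E"]
      openin_subset[of "subtopology (vtop (L0_space M)) (form_domain (L0_space M) E)"]
    by (auto simp: topspace_seminorm_topology)
qed

lemma limitin_form_topology:
  assumes f: "f \<in> dom" and w: "\<forall>\<^sub>F i in F. w i \<in> dom"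
  shows "limitin (form_topology (L0_space M) E) (\<lambda>i. ae_class M (w i)) (ae_class M f) F \<longleftrightarrow>
    (\<forall>U\<in>fmeasurable M. \<forall>r>0. \<forall>\<^sub>F i in F. ldist M U f (w i) < r) \<and>
    (\<forall>r>0. \<forall>\<^sub>F i in F. sqrt (q (\<lambda>x. f x - w i x)) < r)"
proof -
  have ts: "topspace (subtopology (vtop (L0_space M)) (form_domain (L0_space M) E)) =
      topspace (seminorm_topology (L0_space M) E)"
    by (auto simp: topspace_seminorm_topology topspace_vtop_L0_space form_domain_def vcarrier_L0_space)
  have ev: "\<forall>\<^sub>F i in F. ae_class M (w i) \<in> form_domain (L0_space M) E"
    using w by eventually_elim (simp add: form_domain_iff dom_measurable)
  have w': "\<forall>\<^sub>F i in F. w i \<in> borel_measurable M"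
    using w by eventually_elim (rule dom_measurable)
  show ?thesis
    unfolding form_topology_def limitin_generated_by_Un[OF ts] limitin_subtopology
      limitin_vtop_L0_space[OF dom_measurable[OF f] w'] limitin_seminorm_topology[OF f w]
    using f ev by (simp add: form_domain_iff dom_measurable)
qed

end

section \<open>Closed forms on the space of square integrable functions\<close>

lemma ae_class_in_L2_iff_dom:
  "f \<in> borel_measurable M \<Longrightarrow> ae_class M f \<in> L2_classes M \<longleftrightarrow> f \<in> sq.dom M"
  by (simp add: ae_class_in_L2_iff sq_dom_iff)

lemma L2_classes_subset: "L2_classes M \<subseteq> L0_classes M"
  by (auto simp: L2_classes_def)

text \<open>Outside \<open>L2\<close> the parallelogram law reads infinity on both sides, because
  \<open>u\<close> and \<open>v\<close> are half the sum and half the difference of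
  \<open>u + v\<close> and \<open>u - v\<close>, so these cannot both lie in \<open>L2\<close>
  unless \<open>u\<close> and \<open>v\<close> do.\<close>

lemma quadratic_form_extend_to_L0:
  assumes "quadratic_form (L2_space M) E"
  shows "quadratic_form (L0_space M) (extend_to_L0 M E)"
  unfolding quadratic_form_def vcarrier_L0_space
proof (intro conjI ballI allI)
  let ?e = "extend_to_L0 M E"
  have para: "2 * E u + 2 * E v = E (vadd (L0_space M) u v) + E (vdiff (L0_space M) u v)"
    if "u \<in> L2_classes M" "v \<in> L2_classes M" for u v
    using assms that unfolding quadratic_form_def L2_space_simps by blast
  have scale: "E (vscale (L0_space M) c u) = ennreal (\<bar>c\<bar>\<^sup>2) * E u" if "u \<in> L2_classes M" for c u
    using assms that unfolding quadratic_form_def L2_space_simps by blast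
  {
    fix u v assume uv: "u \<in> L0_classes M" "v \<in> L0_classes M"
    obtain f where f: "f \<in> borel_measurable M" "u = ae_class M f"
      using uv(1) by (rule L0_classesE)
    obtain g where g: "g \<in> borel_measurable M" "v = ae_class M g"
      using uv(2) by (rule L0_classesE)
    let ?s = "\<lambda>x. f x + g x" and ?d = "\<lambda>x. f x - g x"
    have eq: "vadd (L0_space M) u v = ae_class M ?s" "vdiff (L0_space M) u v = ae_class M ?d"
      unfolding f(2) g(2) by (rule vadd_ae_class[OF f(1) g(1)], rule vdiff_ae_class[OF f(1) g(1)])
    have meas: "?s \<in> borel_measurable M" "?d \<in> borel_measurable M"
      using f(1) g(1) by measurable
    have L2: "ae_class M ?s \<in> L2_classes M \<and> ae_class M ?d \<in> L2_classes M \<longleftrightarrow>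
        u \<in> L2_classes M \<and> v \<in> L2_classes M"
    proof -
      have "f \<in> sq.dom M \<and> g \<in> sq.dom M" if s: "?s \<in> sq.dom M" and d: "?d \<in> sq.dom M"
      proof -
        have "(\<lambda>x. 1 / 2 * ((f x + g x) + (f x - g x))) \<in> sq.dom M"
          by (intro sq.dom_scale sq.dom_add_diff s d)
        moreover have "(\<lambda>x. 1 / 2 * ((f x + g x) - (f x - g x))) \<in> sq.dom M"
          by (intro sq.dom_scale sq.dom_add_diff s d)
        ultimately show ?thesis
          by simp
      qed
      then show ?thesis
        unfolding f(2) g(2) ae_class_in_L2_iff_dom[OF f(1)] ae_class_in_L2_iff_dom[OF g(1)]
          ae_class_in_L2_iff_dom[OF meas(1)] ae_class_in_L2_iff_dom[OF meas(2)]
        using sq.dom_add_diff by blast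
    qed
    show "2 * ?e u + 2 * ?e v = ?e (vadd (L0_space M) u v) + ?e (vdiff (L0_space M) u v)"
    proof (cases "u \<in> L2_classes M \<and> v \<in> L2_classes M")
      case True
      then show ?thesis
        using L2 para[of u v] by (simp add: extend_to_L0_def eq)
    next
      case False
      then have "2 * ?e u + 2 * ?e v = \<infinity>"
        by (auto simp: extend_to_L0_def ennreal_mult_top)
      moreover have "?e (ae_class M ?s) + ?e (ae_class M ?d) = \<infinity>"
        using False L2 by (auto simp: extend_to_L0_def)
      ultimately show ?thesis
        by (simp only: eq)
    qed
  }
  fix c :: real and u assume u: "u \<in> L0_classes M"
  obtain f where f: "f \<in> borel_measurable M" "u = ae_class M f"
    using u by (rule L0_classesE)
  have eq: "vscale (L0_space M) c u = ae_class M (\<lambda>x. c * f x)"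
    unfolding f(2) by (rule vscale_ae_class[OF f(1)])
  have meas: "(\<lambda>x. c * f x) \<in> borel_measurable M"
    using f(1) by measurable
  show "?e (vscale (L0_space M) c u) = ennreal (\<bar>c\<bar>\<^sup>2) * ?e u"
  proof (cases "u \<in> L2_classes M")
    case True
    then have "f \<in> sq.dom M"
      using f by (simp add: ae_class_in_L2_iff_dom)
    then have "ae_class M (\<lambda>x. c * f x) \<in> L2_classes M"
      unfolding ae_class_in_L2_iff_dom[OF meas] by (rule sq.dom_scale)
    then show ?thesis
      using True scale[OF True, of c] by (simp add: extend_to_L0_def eq)
  next
    case False
    show ?thesis
    proof (cases "c = 0")
      case True
      \<comment> \<open>Scaling a class outside \<open>L2\<close> by \<open>0\<close> lands inside
        \<open>L2\<close>. The zero class has energy \<open>0\<close> by homogeneity there, which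
        matches \<open>0 * \<infinity> = 0\<close>.\<close>
      have z: "ae_class M (\<lambda>x. 0) \<in> L2_classes M"
        by (simp add: ae_class_in_L2_iff_dom sq.dom_zero)
      have "vscale (L0_space M) 0 (ae_class M (\<lambda>x. 0)) = ae_class M (\<lambda>x. 0 * 0)"
        by (rule vscale_ae_class) simp
      then show ?thesis
        using scale[OF z, of 0] z True unfolding eq by (simp add: extend_to_L0_def)
    next
      case c: False
      have "ae_class M (\<lambda>x. c * f x) \<notin> L2_classes M"
      proof
        assume "ae_class M (\<lambda>x. c * f x) \<in> L2_classes M"
        then have "(\<lambda>x. c * f x) \<in> sq.dom M"
          by (simp add: ae_class_in_L2_iff_dom meas)
        from sq.dom_scale[OF this, of "1 / c"] have "f \<in> sq.dom M"
          using c by simp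
        then show False
          using False f by (simp add: ae_class_in_L2_iff_dom)
      qed
      then show ?thesis
        using False c by (simp add: eq extend_to_L0_def ennreal_mult_top)
    qed
  qed
qed

section \<open>Convergence and completeness in \<open>L2\<close> in terms of representatives\<close>

lemma rep_sq_dom: "u \<in> L2_classes M \<Longrightarrow> rep u \<in> sq.dom M"
  by (auto simp: L2_classes_def sq_dom_iff rep_measurable)

lemma L2_dist_eq:
  assumes "u \<in> L2_classes M" "v \<in> L2_classes M"
  shows "L2_dist M u v = sqrt (sq.q M (\<lambda>x. rep u x - rep v x))"
  using assms[THEN rep_sq_dom, THEN sq.dom_measurable] by (simp add: L2_dist_def sq_q_eq)

lemma L2_dist_ae_class:
  assumes "f \<in> sq.dom M" "g \<in> sq.dom M"
  shows "L2_dist M (ae_class M f) (ae_class M g) = sqrt (sq.q M (\<lambda>x. f x - g x))"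
proof -
  note m = assms[THEN sq.dom_measurable]
  note [measurable] = m m[THEN rep_ae_class(1)]
  have "sq.q M (\<lambda>x. rep (ae_class M f) x - rep (ae_class M g) x) = sq.q M (\<lambda>x. f x - g x)"
    unfolding sq.q_def
  proof (rule arg_cong[where f = enn2real], rule sq.cong)
    show "AE x in M. rep (ae_class M f) x - rep (ae_class M g) x = f x - g x"
      using m[THEN rep_ae_class(2)] by eventually_elim simp
  qed measurable
  then show ?thesis
    using assms m by (simp add: L2_dist_eq ae_class_in_L2_iff_dom)
qed

lemma limitin_vtop_L2_space:
  assumes f: "f \<in> sq.dom M" and w: "\<forall>\<^sub>F i in F. w i \<in> sq.dom M"
  shows "limitin (vtop (L2_space M)) (\<lambda>i. ae_class M (w i)) (ae_class M f) F \<longleftrightarrow>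
    (\<forall>r>0. \<forall>\<^sub>F i in F. sqrt (sq.q M (\<lambda>x. f x - w i x)) < r)"
proof -
  have fL: "ae_class M f \<in> L2_classes M"
    using f by (simp add: ae_class_in_L2_iff_dom sq.dom_measurable)
  have "limitin (vtop (L2_space M)) (\<lambda>i. ae_class M (w i)) (ae_class M f) F \<longleftrightarrow>
      (\<forall>d\<in>{L2_dist M}. \<forall>r>0. \<forall>\<^sub>F i in F. d (ae_class M f) (ae_class M (w i)) < r)"
    unfolding L2_space_simps
  proof (rule limitin_pseudometric_topology)
    show "\<forall>\<^sub>F i in F. ae_class M (w i) \<in> L2_classes M"
      using w by eventually_elim (simp add: ae_class_in_L2_iff_dom sq.dom_measurable)
    show "d u v \<le> d u (ae_class M f) + d (ae_class M f) v"
      if "d \<in> {L2_dist M}" "u \<in> L2_classes M" "v \<in> L2_classes M" for d u v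
      using that fL sq.sqrt_q_triangle_diff[OF that(2,3)[THEN rep_sq_dom] rep_sq_dom[OF fL]]
      by (simp add: L2_dist_eq)
  qed (use fL in \<open>auto simp: L2_dist_eq\<close>)
  also have "\<dots> \<longleftrightarrow> (\<forall>r>0. \<forall>\<^sub>F i in F. sqrt (sq.q M (\<lambda>x. f x - w i x)) < r)"
  proof -
    have "(\<forall>\<^sub>F i in F. L2_dist M (ae_class M f) (ae_class M (w i)) < r) \<longleftrightarrow>
        (\<forall>\<^sub>F i in F. sqrt (sq.q M (\<lambda>x. f x - w i x)) < r)" for r
      by (rule eventually_subst, use w in eventually_elim) (simp add: L2_dist_ae_class f)
    then show ?thesis
      by simp
  qed
  finally show ?thesis .
qed

locale L2_closed_form =
  fixes M :: "'a measure" and E :: "('a \<Rightarrow> real) set \<Rightarrow> ennreal"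
  assumes closed: "closed_form (L2_space M) E"
begin

sublocale L0_class_form M "extend_to_L0 M E"
  by standard (use closed in \<open>auto simp: closed_form_def intro: quadratic_form_extend_to_L0\<close>)

lemma form_domain_L2_space:
  "form_domain (L2_space M) E = form_domain (L0_space M) (extend_to_L0 M E)"
  using L2_classes_subset[of M]
  by (auto simp: form_domain_def L2_space_simps vcarrier_L0_space extend_to_L0_def split: if_splits)

lemma dom_sq_dom: "f \<in> dom \<Longrightarrow> f \<in> sq.dom M"
  unfolding dom_def by (auto simp: extend_to_L0_def ae_class_in_L2_iff_dom split: if_splits)

text \<open>The two forms may differ outside \<open>L2\<close>, but a difference of two elements of
  the domain stays in \<open>L2\<close>, so all subbasic balls coincide.\<close>

lemma seminorm_topology_L2_space:
  "seminorm_topology (L2_space M) E = seminorm_topology (L0_space M) (extend_to_L0 M E)"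
proof -
  let ?D = "form_domain (L0_space M) (extend_to_L0 M E)"
  have "form_seminorm E (vdiff (L0_space M) u v) =
      form_seminorm (extend_to_L0 M E) (vdiff (L0_space M) u v)" if "u \<in> ?D" "v \<in> ?D" for u v
  proof -
    have L0: "u \<in> L0_classes M" "v \<in> L0_classes M"
      using that by (simp_all add: form_domain_def vcarrier_L0_space)
    have d: "(\<lambda>x. rep u x - rep v x) \<in> dom"
      by (intro dom_add_diff rep_in_dom that)
    have "vdiff (L0_space M) u v = ae_class M (\<lambda>x. rep u x - rep v x)"
      using vdiff_ae_class[OF L0[THEN rep_measurable]] L0 by (simp add: ae_class_rep)
    moreover have "ae_class M (\<lambda>x. rep u x - rep v x) \<in> L2_classes M"
      using ae_class_in_L2_iff_dom[OF dom_measurable[OF d]] dom_sq_dom[OF d] by simp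
    ultimately show ?thesis
      by (simp add: form_seminorm_def extend_to_L0_def)
  qed
  then have "(\<lambda>(u, r). {v \<in> ?D. form_seminorm E (vdiff (L0_space M) u v) < r}) ` (?D \<times> {0<..}) =
      (\<lambda>(u, r). {v \<in> ?D. form_seminorm (extend_to_L0 M E) (vdiff (L0_space M) u v) < r}) ` (?D \<times> {0<..})"
    by (intro image_cong) auto
  moreover have "{{v \<in> S. d u v < r} | d u r. d \<in> {d0} \<and> u \<in> S \<and> 0 < r} =
      (\<lambda>(u, r). {v \<in> S. d0 u v < r}) ` (S \<times> {0<..})"
    for S and d0 :: "('a \<Rightarrow> real) set \<Rightarrow> ('a \<Rightarrow> real) set \<Rightarrow> real"
    by auto
  ultimately show ?thesis
    by (simp only: seminorm_topology_def pseudometric_topology_def form_domain_L2_space L2_space_simps)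
qed

lemma limitin_form_topology_L2_space:
  assumes f: "f \<in> dom" and w: "\<forall>\<^sub>F i in F. w i \<in> dom"
  shows "limitin (form_topology (L2_space M) E) (\<lambda>i. ae_class M (w i)) (ae_class M f) F \<longleftrightarrow>
    (\<forall>r>0. \<forall>\<^sub>F i in F. sqrt (sq.q M (\<lambda>x. f x - w i x)) < r) \<and>
    (\<forall>r>0. \<forall>\<^sub>F i in F. sqrt (q (\<lambda>x. f x - w i x)) < r)"
proof -
  have "topspace (vtop (L2_space M)) = L2_classes M"
    unfolding L2_space_simps by (rule topspace_pseudometric_topology) (auto simp: L2_dist_eq)
  then have ts: "topspace (subtopology (vtop (L2_space M)) (form_domain (L2_space M) E)) =
      topspace (seminorm_topology (L0_space M) (extend_to_L0 M E))"
    unfolding topspace_subtopology topspace_seminorm_topology form_domain_L2_space[symmetric]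
    by (auto simp: form_domain_def L2_space_simps(1))
  have ev: "\<forall>\<^sub>F i in F. ae_class M (w i) \<in> form_domain (L0_space M) (extend_to_L0 M E)"
    using w by eventually_elim (simp add: form_domain_iff dom_measurable)
  have w': "\<forall>\<^sub>F i in F. w i \<in> sq.dom M"
    using w by eventually_elim (rule dom_sq_dom)
  show ?thesis
    unfolding form_topology_def seminorm_topology_L2_space limitin_generated_by_Un[OF ts] limitin_subtopology
      limitin_vtop_L2_space[OF dom_sq_dom[OF f] w'] limitin_seminorm_topology[OF f w]
    using f ev by (simp add: form_domain_iff dom_measurable form_domain_L2_space)
qed

lemma vzero_L2_space: "vzero (L2_space M) = ae_class M (\<lambda>x. 0)"
  by (simp add: L2_space_def L0_space_def)

lemma topspace_form_topology_L2_space: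
  "topspace (form_topology (L2_space M) E) \<subseteq> form_domain (L0_space M) (extend_to_L0 M E)"
  unfolding form_topology_def topology_generated_by_topspace seminorm_topology_L2_space
  using openin_subset[of "seminorm_topology (L0_space M) (extend_to_L0 M E)"]
    openin_subset[of "subtopology (vtop (L2_space M)) (form_domain (L2_space M) E)"]
  by (auto simp: topspace_seminorm_topology form_domain_L2_space)

text \<open>Completeness is given for filters. The tail filter of the sequence is Cauchy for both
  seminorms, hence convergent in the form topology, and uniqueness of \<open>L2\<close> limits
  identifies its limit with \<open>f\<close>.\<close>

lemma complete_sequence:
  assumes w: "\<And>k. w k \<in> dom" and f: "f \<in> sq.dom M"
    and cauchy: "\<And>r. 0 < r \<Longrightarrow> \<exists>N. \<forall>k\<ge>N. \<forall>l\<ge>N. q (\<lambda>x. w k x - w l x) < r"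
    and lim: "(\<lambda>k. sq.q M (\<lambda>x. w k x - f x)) \<longlonglongrightarrow> 0"
  shows "f \<in> dom" "(\<lambda>k. q (\<lambda>x. f x - w k x)) \<longlonglongrightarrow> 0"
proof -
  let ?T = "form_topology (L2_space M) E"
  define F where "F = filtermap (\<lambda>k. ae_class M (w k)) sequentially"
  have ts: "ae_class M g \<in> topspace ?T \<longleftrightarrow> g \<in> dom" if "g \<in> borel_measurable M" for g
  proof -
    have "limitin ?T (\<lambda>k. ae_class M g) (ae_class M g) sequentially" if "g \<in> dom"
      using that by (subst limitin_form_topology_L2_space) auto
    then show ?thesis
      using form_domain_iff[OF that] topspace_form_topology_L2_space by (auto simp: limitin_def)
  qed
  have F: "F \<noteq> bot" "F \<le> principal (topspace ?T)"
    using w by (auto simp: F_def filtermap_bot_iff le_principal eventually_filtermap ts dom_measurable)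
  have fin: "\<exists>N. \<forall>k\<ge>N. sqrt (sq.q M (\<lambda>x. w k x - f x)) < r" if "0 < r" for r
  proof -
    have "(\<lambda>k. sqrt (sq.q M (\<lambda>x. w k x - f x))) \<longlonglongrightarrow> sqrt 0"
      by (intro tendsto_intros lim)
    then have "\<forall>\<^sub>F k in sequentially. sqrt (sq.q M (\<lambda>x. w k x - f x)) < r"
      using that by (intro order_tendstoD) auto
    then show ?thesis
      by (simp add: eventually_sequentially)
  qed
  have wsq: "w k \<in> sq.dom M" for k
    by (rule dom_sq_dom[OF w])
  have "vcauchy_filter (L2_space M) ?T F"
    unfolding vcauchy_filter_def
  proof (intro allI impI)
    fix W assume W: "openin ?T W \<and> vzero (L2_space M) \<in> W"
    let ?w = "\<lambda>p. \<lambda>x. w (fst p) x - w (snd p) x"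
    \<comment> \<open>The Cauchy condition is the convergence to zero of the differences along the
      product filter, so that the description of limits in the form topology applies.\<close>
    have "limitin ?T (\<lambda>p. ae_class M (?w p)) (ae_class M (\<lambda>x. 0)) (sequentially \<times>\<^sub>F sequentially)"
    proof (subst limitin_form_topology_L2_space)
      show "(\<lambda>x. 0) \<in> dom"
        by (rule dom_zero)
      show "\<forall>\<^sub>F p in sequentially \<times>\<^sub>F sequentially. ?w p \<in> dom"
        by (intro always_eventually allI dom_add_diff w)
      have *: "q (\<lambda>x. 0 - ?w p x) = q (?w p)" "sq.q M (\<lambda>x. 0 - ?w p x) = sq.q M (?w p)" for p
        using q_minus_commute[OF dom_zero dom_add_diff(2)[OF w[of "fst p"] w[of "snd p"]]]
          sq.q_minus_commute[OF sq.dom_zero sq.dom_add_diff(2)[OF wsq[of "fst p"] wsq[of "snd p"]]]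
        by simp_all
      have "\<exists>N. \<forall>k\<ge>N. \<forall>l\<ge>N. sqrt (sq.q M (\<lambda>x. w l x - w k x)) < r" if r: "0 < r" for r
      proof -
        obtain N where N: "\<And>k. k \<ge> N \<Longrightarrow> sqrt (sq.q M (\<lambda>x. w k x - f x)) < r / 2"
          using fin[of "r / 2"] r by auto
        have "sqrt (sq.q M (\<lambda>x. w l x - w k x)) < r" if "k \<ge> N" "l \<ge> N" for k l
          using sq.sqrt_q_triangle_diff[OF wsq wsq f, of l k] N[OF that(1)] N[OF that(2)]
          unfolding sq.q_minus_commute[OF f wsq] by linarith
        then show ?thesis
          by blast
      qed
      moreover have "\<exists>N. \<forall>k\<ge>N. \<forall>l\<ge>N. sqrt (q (\<lambda>x. w l x - w k x)) < r" if r: "0 < r" for r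
      proof -
        obtain N where "\<forall>k\<ge>N. \<forall>l\<ge>N. q (\<lambda>x. w k x - w l x) < r\<^sup>2"
          using cauchy[of "r\<^sup>2"] r by auto
        then have "\<forall>k\<ge>N. \<forall>l\<ge>N. sqrt (q (\<lambda>x. w l x - w k x)) < r"
          using r by (auto intro!: real_less_lsqrt)
        then show ?thesis
          by blast
      qed
      ultimately show "(\<forall>r>0. \<forall>\<^sub>F p in sequentially \<times>\<^sub>F sequentially. sqrt (sq.q M (\<lambda>x. 0 - ?w p x)) < r) \<and>
          (\<forall>r>0. \<forall>\<^sub>F p in sequentially \<times>\<^sub>F sequentially. sqrt (q (\<lambda>x. 0 - ?w p x)) < r)"
        unfolding * eventually_prod_sequentially by simp
    qed
    then have "\<forall>\<^sub>F p in sequentially \<times>\<^sub>F sequentially. ae_class M (?w p) \<in> W"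
      using W by (auto simp: limitin_def vzero_L2_space)
    then show "\<forall>\<^sub>F (u, v) in F \<times>\<^sub>F F. vdiff (L2_space M) u v \<in> W"
      unfolding F_def prod_filtermap1 prod_filtermap2 eventually_filtermap L2_space_simps
      by (simp add: vdiff_ae_class dom_measurable w case_prod_beta)
  qed
  then obtain u where u: "limitin ?T (\<lambda>v. v) u F"
    using closed F unfolding closed_form_def vcomplete_def by blast
  have "u \<in> form_domain (L0_space M) (extend_to_L0 M E)"
    using u topspace_form_topology_L2_space by (auto simp: limitin_def)
  then have g: "rep u \<in> dom" "ae_class M (rep u) = u"
    by (auto simp: rep_in_dom form_domain_def vcarrier_L0_space ae_class_rep)
  have "limitin ?T (\<lambda>k. ae_class M (w k)) (ae_class M (rep u)) sequentially"
    using u unfolding g(2) by (simp add: F_def limitin_def eventually_filtermap)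
  then have lims: "\<And>r. 0 < r \<Longrightarrow> \<forall>\<^sub>F k in sequentially. sqrt (sq.q M (\<lambda>x. rep u x - w k x)) < r"
      "\<And>r. 0 < r \<Longrightarrow> \<forall>\<^sub>F k in sequentially. sqrt (q (\<lambda>x. rep u x - w k x)) < r"
    using w by (subst (asm) limitin_form_topology_L2_space[OF g(1)]; simp)+
  have gsq: "rep u \<in> sq.dom M"
    by (rule dom_sq_dom[OF g(1)])
  \<comment> \<open>The abstract limit \<open>u\<close> and the given \<open>f\<close> are both
    \<open>L2\<close> limits of \<open>w\<close>, hence equal almost everywhere.\<close>
  have "sqrt (sq.q M (\<lambda>x. rep u x - f x)) \<le> 0 + e" if e: "0 < e" for e
  proof -
    obtain N where N: "\<And>k. k \<ge> N \<Longrightarrow> sqrt (sq.q M (\<lambda>x. w k x - f x)) < e / 2"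
      using fin[of "e / 2"] e by auto
    have "\<forall>\<^sub>F k in sequentially. sqrt (sq.q M (\<lambda>x. rep u x - w k x)) < e / 2"
      using e by (intro lims(1)) simp
    then obtain N' where N': "\<And>k. k \<ge> N' \<Longrightarrow> sqrt (sq.q M (\<lambda>x. rep u x - w k x)) < e / 2"
      by (auto simp: eventually_sequentially)
    show ?thesis
      using sq.sqrt_q_triangle_diff[OF gsq f wsq, of "max N N'"] N[of "max N N'"] N'[of "max N N'"]
      by simp
  qed
  then have "sqrt (sq.q M (\<lambda>x. rep u x - f x)) \<le> 0"
    by (rule field_le_epsilon)
  then have "sq.q M (\<lambda>x. rep u x - f x) = 0"
    using sq.q_nonneg[of M "\<lambda>x. rep u x - f x"] by simp
  then have "(LINT x|M. (rep u x - f x)\<^sup>2) = 0"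
    unfolding sq_q_eq[OF sq.dom_measurable[OF sq.dom_add_diff(2)[OF gsq f]]] .
  moreover have "integrable M (\<lambda>x. (rep u x - f x)\<^sup>2)"
    using sq.dom_add_diff(2)[OF gsq f] by (simp add: sq_dom_iff)
  ultimately have ae: "AE x in M. rep u x = f x"
    by (subst (asm) integral_nonneg_eq_0_iff_AE) auto
  have fm: "f \<in> borel_measurable M"
    using f by (rule sq.dom_measurable)
  have "u = ae_class M f"
    using ae_class_eq_iff[OF dom_measurable[OF g(1)] fm] ae g(2) by simp
  then show fd: "f \<in> dom"
    using g by (simp add: dom_def fm)
  have "q (\<lambda>x. rep u x - w k x) = q (\<lambda>x. f x - w k x)" for k
  proof -
    have "ae_class M (\<lambda>x. rep u x - w k x) = ae_class M (\<lambda>x. f x - w k x)"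
      using ae dom_measurable[OF dom_add_diff(2)[OF g(1) w]] dom_measurable[OF dom_add_diff(2)[OF fd w]]
      by (subst ae_class_eq_iff) auto
    then show ?thesis
      by (simp add: q_def)
  qed
  note eq = this
  show "(\<lambda>k. q (\<lambda>x. f x - w k x)) \<longlonglongrightarrow> 0"
  proof (rule order_tendstoI)
    fix a :: real assume "0 < a"
    then have "\<forall>\<^sub>F k in sequentially. sqrt (q (\<lambda>x. rep u x - w k x)) < sqrt a"
      by (intro lims) simp
    then show "\<forall>\<^sub>F k in sequentially. q (\<lambda>x. f x - w k x) < a"
      by (simp add: eq)
  qed (auto intro!: always_eventually less_le_trans[OF _ q_nonneg])
qed

text \<open>Almost minimizers of \<open>q\<close> in a decreasing sequence of midpoint convex sets form a
  \<open>q\<close>-Cauchy sequence, by the parallelogram law.\<close>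

lemma lsc_L2:
  assumes f: "f \<in> sq.dom M" and g: "\<And>k. g k \<in> dom" "\<And>k. q (g k) \<le> c"
    and lim: "(\<lambda>k. sq.q M (\<lambda>x. g k x - f x)) \<longlonglongrightarrow> 0"
  shows "f \<in> dom" "q f \<le> c"
proof -
  \<comment> \<open>Shrinking \<open>L2\<close> balls around \<open>f\<close> cut with a sublevel
    set of \<open>q\<close>. Both conditions survive midpoints, and they hold for the members of
    \<open>g\<close> that are close to \<open>f\<close>.\<close>
  define R where "R i = {w \<in> dom. sq.q M (\<lambda>x. w x - f x) \<le> 1 / real (Suc i) \<and> q w \<le> c}" for i :: nat
  have "\<exists>w\<in>R i. q w \<le> c" for i
  proof -
    have "\<forall>\<^sub>F k in sequentially. sq.q M (\<lambda>x. g k x - f x) < 1 / real (Suc i)"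
      by (rule order_tendstoD(2)[OF lim]) simp
    then obtain k where "sq.q M (\<lambda>x. g k x - f x) < 1 / real (Suc i)"
      by (auto simp: eventually_sequentially)
    then show ?thesis
      using g by (intro bexI[of _ "g k"]) (auto simp: R_def)
  qed
  then obtain m where m1: "\<And>i \<tau>. 0 < \<tau> \<Longrightarrow> \<exists>x\<in>R i. q x < m + \<tau>"
    and m2: "\<And>\<tau>. 0 < \<tau> \<Longrightarrow> \<exists>i. \<forall>x\<in>R i. m - \<tau> < q x"
    using sup_inf_obtain[of UNIV q R c] by auto
  have "\<exists>x. x \<in> R k \<and> q x < m + 1 / real (Suc k)" for k
    using m1[of "1 / real (Suc k)" k] by auto
  then obtain w where w: "\<And>k. w k \<in> R k" "\<And>k. q (w k) < m + 1 / real (Suc k)"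
    by metis
  have R_mono: "R j \<subseteq> R i" if "i \<le> j" for i j
  proof -
    have "1 / real (Suc j) \<le> 1 / real (Suc i)"
      using that by (simp add: frac_le)
    then show ?thesis
      by (auto simp: R_def)
  qed
  have R_mid: "(\<lambda>x. (u x + v x) / 2) \<in> R i" if "u \<in> R i" "v \<in> R i" for u v i
  proof -
    have uv: "u \<in> dom" "v \<in> dom"
      using that by (auto simp: R_def)
    have "sq.q M (\<lambda>x. ((u x - f x) + (v x - f x)) / 2) \<le> 1 / real (Suc i)"
      using that by (intro sq.q_mid_le sq.dom_add_diff f dom_sq_dom uv) (auto simp: R_def)
    moreover have "(\<lambda>x. ((u x - f x) + (v x - f x)) / 2) = (\<lambda>x. (u x + v x) / 2 - f x)"
      by (auto simp: field_simps)
    ultimately show ?thesis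
      using q_mid(2)[OF uv] q_mid_le[OF uv] that by (auto simp: R_def)
  qed
  have wd: "w k \<in> dom" for k
    using w(1)[of k] by (simp add: R_def)
  have cauchy: "\<exists>N. \<forall>k\<ge>N. \<forall>l\<ge>N. q (\<lambda>x. w k x - w l x) < r" if r: "0 < r" for r
  proof -
    \<comment> \<open>With tolerance \<open>r / 8\<close> the midpoint identity gives
      \<open>2 * (m + r / 8) + 2 * (m + r / 8) - 4 * (m - r / 8) = r\<close>.\<close>
    obtain i where i: "\<And>x. x \<in> R i \<Longrightarrow> m - r / 8 < q x"
      using m2[of "r / 8"] r by auto
    obtain N0 where N0: "8 / r < real N0"
      using reals_Archimedean2 by blast
    have "q (\<lambda>x. w k x - w l x) < r" if kl: "k \<ge> max i N0" "l \<ge> max i N0" for k l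
    proof -
      have "1 / real (Suc j) < r / 8" if "j \<ge> N0" for j
      proof -
        have "8 / r < real (Suc j)"
          using N0 that by linarith
        then show ?thesis
          using r by (simp add: field_simps)
      qed
      then have "1 / real (Suc k) < r / 8" "1 / real (Suc l) < r / 8"
        using kl by auto
      moreover have "m - r / 8 < q (\<lambda>x. (w k x + w l x) / 2)"
        using R_mono[of i k] R_mono[of i l] kl w(1) by (intro i R_mid) auto
      ultimately show ?thesis
        using q_mid(1)[OF wd[of k] wd[of l]] w(2)[of k] w(2)[of l] by linarith
    qed
    then show ?thesis
      by blast
  qed
  have "(\<lambda>k. sq.q M (\<lambda>x. w k x - f x)) \<longlonglongrightarrow> 0"
  proof (rule tendsto_sandwich[OF _ _ tendsto_const])
    show "\<forall>\<^sub>F k in sequentially. sq.q M (\<lambda>x. w k x - f x) \<le> 1 / real (Suc k)"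
      using w(1) by (auto simp: R_def)
    show "(\<lambda>k. 1 / real (Suc k)) \<longlonglongrightarrow> 0"
      by (rule LIMSEQ_Suc[OF lim_1_over_n])
  qed auto
  note c = complete_sequence[OF wd f cauchy this]
  show fd: "f \<in> dom"
    by (rule c(1))
  have "(\<lambda>k. sqrt (q (\<lambda>x. f x - w k x)) + sqrt c) \<longlonglongrightarrow> sqrt 0 + sqrt c"
    by (intro tendsto_intros c(2))
  moreover have "sqrt (q f) \<le> sqrt (q (\<lambda>x. f x - w k x)) + sqrt c" for k
  proof -
    have "sqrt (q (w k)) \<le> sqrt c"
      using w(1)[of k] by (simp add: R_def)
    moreover have "sqrt (q f) \<le> sqrt (q (\<lambda>x. f x - w k x)) + sqrt (q (w k))"
      using sqrt_q_triangle[OF dom_add_diff(2)[OF fd wd[of k]] wd[of k]] by simp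
    ultimately show ?thesis
      by linarith
  qed
  ultimately have "sqrt (q f) \<le> sqrt 0 + sqrt c"
    by (intro LIMSEQ_le_const) auto
  then show "q f \<le> c"
    by simp
qed

end

section \<open>Dirichlet forms\<close>

text \<open>The scaled cutoff is the identity on \<open>[0, n]\<close>. Below \<open>0\<close>,
  monotonicity and the range of \<open>C\<close> confine it to \<open>[-1/n, 0]\<close>, which is
  why the cutoff parameter is \<open>1 / n\<^sup>2\<close>. Above \<open>n\<close> it lies between
  \<open>n\<close> and \<open>y\<close>, by monotonicity and contraction.\<close>

lemma cutoff_scaled_dist:
  assumes C: "cutoff (1 / n\<^sup>2) C" and n: "0 < n"
  shows "\<bar>n * C (y / n) - max 0 y\<bar> \<le> \<bar>y\<bar>" and "y \<le> n \<Longrightarrow> \<bar>n * C (y / n) - max 0 y\<bar> \<le> 1 / n"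
proof -
  have nc: "\<bar>C x\<bar> \<le> \<bar>x\<bar>" for x
  proof -
    have "\<bar>C x - C 0\<bar> \<le> \<bar>x - 0\<bar>" "C 0 = 0"
      using C unfolding cutoff_def normal_contraction_def by blast+
    then show ?thesis
      by simp
  qed
  have C_mono: "C a \<le> C b" if "a \<le> b" for a b
    using C that by (auto simp: cutoff_def mono_def)
  have C0: "C 0 = 0" and C1: "C x = x" if "0 \<le> x" "x \<le> 1" for x
    using C by (auto simp: cutoff_def normal_contraction_def that)
  have lower: "- (1 / n\<^sup>2) \<le> C x" for x
  proof -
    have "C x \<in> {- (1 / n\<^sup>2)..1 + 1 / n\<^sup>2}"
      using C unfolding cutoff_def by blast
    then show ?thesis
      by simp
  qed
  have scaled: "\<bar>n * C (y / n)\<bar> \<le> \<bar>y\<bar>"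
    using nc[of "y / n"] n by (simp add: abs_mult field_simps)
  consider "y \<le> 0" | "0 \<le> y" "y \<le> n" | "n \<le> y"
    by linarith
  then have "\<bar>n * C (y / n) - max 0 y\<bar> \<le> \<bar>y\<bar> \<and> (y \<le> n \<longrightarrow> \<bar>n * C (y / n) - max 0 y\<bar> \<le> 1 / n)"
  proof cases
    case 1
    have "C (y / n) \<le> 0"
      using C_mono[of "y / n" 0] C0[of 0] 1 n by (simp add: divide_nonpos_pos)
    moreover have "n * - (1 / n\<^sup>2) \<le> n * C (y / n)"
      using lower n by (intro mult_left_mono) auto
    ultimately show ?thesis
      using 1 n scaled by (simp add: power2_eq_square mult_nonneg_nonpos)
  next
    case 2
    then show ?thesis
      using C1[of "y / n"] n by simp
  next
    case 3
    have "1 \<le> C (y / n)"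
      using C_mono[of 1 "y / n"] C1[of 1] 3 n by simp
    then have "n \<le> n * C (y / n)"
      using n by simp
    then show ?thesis
      using 3 n scaled C1[of "y / n"] by auto
  qed
  then show "\<bar>n * C (y / n) - max 0 y\<bar> \<le> \<bar>y\<bar>" "y \<le> n \<Longrightarrow> \<bar>n * C (y / n) - max 0 y\<bar> \<le> 1 / n"
    by auto
qed

lemma sq_dom_dominated:
  assumes f: "f \<in> sq.dom M" and g: "g \<in> borel_measurable M" and le: "\<And>x. \<bar>g x\<bar> \<le> \<bar>f x\<bar>"
  shows "g \<in> sq.dom M"
proof -
  have "integrable M (\<lambda>x. (g x)\<^sup>2)"
  proof (rule Bochner_Integration.integrable_bound)
    show "integrable M (\<lambda>x. (f x)\<^sup>2)"
      using f by (simp add: sq_dom_iff)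
    show "AE x in M. norm ((g x)\<^sup>2) \<le> norm ((f x)\<^sup>2)"
      using le by (intro AE_I2) (simp add: abs_le_square_iff)
  qed (use g in measurable)
  then show ?thesis
    using g by (simp add: sq_dom_iff)
qed

lemma sq_dominated_convergence:
  assumes f: "f \<in> sq.dom M" and g: "\<And>k. g k \<in> borel_measurable M" and le: "\<And>k x. \<bar>g k x\<bar> \<le> \<bar>f x\<bar>"
    and lim: "\<And>x. (\<lambda>k. g k x) \<longlonglongrightarrow> 0"
  shows "(\<lambda>k. sq.q M (g k)) \<longlonglongrightarrow> 0"
proof -
  note [measurable] = g
  have "(\<lambda>k. LINT x|M. (g k x)\<^sup>2) \<longlonglongrightarrow> (LINT x|M. 0)"
  proof (rule integral_dominated_convergence)
    show "integrable M (\<lambda>x. (f x)\<^sup>2)"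
      using f by (simp add: sq_dom_iff)
    show "AE x in M. (\<lambda>k. (g k x)\<^sup>2) \<longlonglongrightarrow> 0"
      using tendsto_power[OF lim, where n = 2] by (intro AE_I2) simp
    show "AE x in M. norm ((g k x)\<^sup>2) \<le> (f x)\<^sup>2" for k
      using le[of k] by (intro AE_I2) (simp add: abs_le_square_iff)
  qed measurable
  then show ?thesis
    using g by (simp add: sq_q_eq)
qed

locale L2_dirichlet_form = L2_closed_form +
  assumes markov: "markovian M E"
begin

text \<open>The scaled cutoffs \<open>n C (\<cdot> / n)\<close> with \<open>\<epsilon> = 1 / n\<^sup>2\<close> tend to the positive part.\<close>

lemma pos_part:
  assumes f: "f \<in> dom"
  shows "(\<lambda>x. max 0 (f x)) \<in> dom" "q (\<lambda>x. max 0 (f x)) \<le> q f"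
proof -
  define n where "n k = real (Suc k)" for k
  have n: "0 < n k" for k
    by (simp add: n_def)
  have "\<exists>C. cutoff (1 / (n k)\<^sup>2) C \<and> (\<forall>u\<in>L2_classes M. E (class_comp M C u) \<le> E u)" for k
    using markov n[of k] unfolding markovian_def by simp
  then obtain C where C: "\<And>k. cutoff (1 / (n k)\<^sup>2) (C k)"
    and CE: "\<And>k u. u \<in> L2_classes M \<Longrightarrow> E (class_comp M (C k) u) \<le> E u"
    by metis
  have nc: "normal_contraction (C k)" for k
    using C by (auto simp: cutoff_def)
  have Cm: "C k \<in> borel_measurable borel" for k
    by (rule normal_contraction_borel[OF nc])
  have fm: "f \<in> borel_measurable M"
    using f by (rule dom_measurable)
  note [measurable] = Cm fm
  define h where "h k = (\<lambda>x. C k (f x / n k))" for k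
  have hm: "h k \<in> borel_measurable M" for k
    unfolding h_def by measurable
  have h: "h k \<in> dom \<and> q (h k) \<le> q (\<lambda>x. f x / n k)" for k
  proof -
    have fn: "(\<lambda>x. f x / n k) \<in> dom"
      using dom_scale[OF f, of "1 / n k"] by simp
    have fnm: "(\<lambda>x. f x / n k) \<in> borel_measurable M"
      using fn by (rule dom_measurable)
    have fn2: "ae_class M (\<lambda>x. f x / n k) \<in> L2_classes M"
      unfolding ae_class_in_L2_iff_dom[OF fnm] using fn by (rule dom_sq_dom)
    have "\<bar>C k y\<bar> \<le> \<bar>y\<bar>" for y
    proof -
      have "\<bar>C k y - C k 0\<bar> \<le> \<bar>y - 0\<bar>" "C k 0 = 0"
        using nc[of k] unfolding normal_contraction_def by blast+
      then show ?thesis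
        by simp
    qed
    then have "\<bar>h k x\<bar> \<le> \<bar>f x / n k\<bar>" for x
      unfolding h_def .
    then have h2: "ae_class M (h k) \<in> L2_classes M"
      unfolding ae_class_in_L2_iff_dom[OF hm] by (rule sq_dom_dominated[OF dom_sq_dom[OF fn] hm])
    have "class_comp M (C k) (ae_class M (\<lambda>x. f x / n k)) = ae_class M (h k)"
      unfolding h_def by (rule class_comp_ae_class[OF fnm nc])
    then have "E (ae_class M (h k)) \<le> E (ae_class M (\<lambda>x. f x / n k))"
      using CE[OF fn2, of k] by simp
    then have "extend_to_L0 M E (ae_class M (h k)) \<le> extend_to_L0 M E (ae_class M (\<lambda>x. f x / n k))"
      unfolding extend_to_L0_def using fn2 h2 by simp
    also have "\<dots> = ennreal (q (\<lambda>x. f x / n k))"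
      by (rule Q_eq_q[OF fn])
    finally show ?thesis
      using dom_le[OF hm] q_le[OF q_nonneg] by blast
  qed
  \<comment> \<open>The Markov property was used for \<open>f / n\<close>. Scaling back by
    \<open>n\<close> multiplies the energy by the square that was divided out, so the bound
    \<open>q f\<close> is uniform in \<open>k\<close>.\<close>
  define g where "g k = (\<lambda>x. n k * h k x)" for k
  have g: "g k \<in> dom" "q (g k) \<le> q f" for k
  proof -
    show "g k \<in> dom"
      unfolding g_def using h by (intro dom_scale) simp
    have "q (g k) \<le> (n k)\<^sup>2 * q (\<lambda>x. f x / n k)"
      unfolding g_def using h by (subst q_scale) (auto intro: mult_left_mono)
    also have "\<dots> = (n k)\<^sup>2 * ((1 / n k)\<^sup>2 * q f)"
      using q_scale[OF f, of "1 / n k"] by simp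
    also have "\<dots> = q f"
      using n[of k] by (simp add: power_divide)
    finally show "q (g k) \<le> q f" .
  qed
  have p: "(\<lambda>x. max 0 (f x)) \<in> sq.dom M"
    using dom_sq_dom[OF f] by (rule sq_dom_dominated) auto
  have "(\<lambda>k. sq.q M (\<lambda>x. g k x - max 0 (f x))) \<longlonglongrightarrow> 0"
  proof (rule sq_dominated_convergence[OF dom_sq_dom[OF f]])
    show "(\<lambda>x. g k x - max 0 (f x)) \<in> borel_measurable M" for k
      using dom_measurable[OF g(1), of k] by measurable
    show "\<bar>g k x - max 0 (f x)\<bar> \<le> \<bar>f x\<bar>" for k x
      using cutoff_scaled_dist(1)[OF C n] by (simp add: g_def h_def)
    show "(\<lambda>k. g k x - max 0 (f x)) \<longlonglongrightarrow> 0" for x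
    proof (rule Lim_null_comparison)
      obtain N where "f x < real N"
        using reals_Archimedean2 by blast
      then have "norm (g k x - max 0 (f x)) \<le> 1 / real (Suc k)" if "k \<ge> N" for k
        using cutoff_scaled_dist(2)[OF C n, of "f x" k] that by (simp add: g_def h_def n_def)
      then show "\<forall>\<^sub>F k in sequentially. norm (g k x - max 0 (f x)) \<le> 1 / real (Suc k)"
        unfolding eventually_sequentially by blast
      show "(\<lambda>k. 1 / real (Suc k)) \<longlonglongrightarrow> 0"
        by (rule LIMSEQ_Suc[OF lim_1_over_n])
    qed
  qed
  then show "(\<lambda>x. max 0 (f x)) \<in> dom" "q (\<lambda>x. max 0 (f x)) \<le> q f"
    using lsc_L2[OF p g] by auto
qed

text \<open>Since \<open>(r - s)\<^sup>+ = r - min r s\<close> is dominated by \<open>r\<close>, it tends to \<open>r\<close> in \<open>L\<^sup>2\<close> when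
  \<open>s \<rightarrow> 0\<close> locally in measure.\<close>

lemma q_le_of_nonneg_perturbation:
  assumes r: "r \<in> dom" and r0: "\<And>x. 0 \<le> r x"
    and s: "\<And>U \<delta>. U \<in> fmeasurable M \<Longrightarrow> 0 < \<delta> \<Longrightarrow>
      \<exists>s\<in>dom. (\<forall>x. 0 \<le> s x) \<and> ldist M U (\<lambda>x. 0) s < \<delta> \<and> q (\<lambda>x. r x - s x) \<le> c"
  shows "q r \<le> c"
proof -
  define n where "n k = real (Suc k)" for k
  have n: "1 \<le> n k" for k
    by (simp add: n_def)
  \<comment> \<open>These sets have finite measure by Chebyshev's inequality, as \<open>r\<close> is
    in \<open>L2\<close>, so the hypothesis on small perturbations applies on them. They exhaust the
    set where \<open>r\<close> is nonzero.\<close>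
  define U where "U k = {x \<in> space M. 1 / n k \<le> r x \<and> r x \<le> n k}" for k
  have [measurable]: "r \<in> borel_measurable M"
    using r by (rule dom_measurable)
  have r2: "r \<in> sq.dom M" "integrable M (\<lambda>x. (r x)\<^sup>2)"
    using dom_sq_dom[OF r] by (auto simp: sq_dom_iff)
  have Um [measurable]: "U k \<in> sets M" for k
    unfolding U_def by measurable
  have Uf: "U k \<in> fmeasurable M" for k
  proof -
    have "emeasure M {x \<in> space M. (r x)\<^sup>2 \<ge> (1 / n k)\<^sup>2} \<le> ennreal (1 / (1 / n k)\<^sup>2 * (LINT x|M. (r x)\<^sup>2))"
      using r2 n[of k] by (intro integral_Markov_inequality) auto
    moreover have "emeasure M (U k) \<le> emeasure M {x \<in> space M. (r x)\<^sup>2 \<ge> (1 / n k)\<^sup>2}"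
      using n[of k] by (intro emeasure_mono) (auto simp: U_def intro!: power_mono)
    ultimately have "emeasure M (U k) \<le> ennreal (1 / (1 / n k)\<^sup>2 * (LINT x|M. (r x)\<^sup>2))"
      by (rule order_trans[rotated])
    then have "emeasure M (U k) < \<infinity>"
      by (rule le_less_trans) simp
    then show ?thesis
      using Um[of k] by (simp add: fmeasurable_iff)
  qed
  \<comment> \<open>The cube compensates a loss of the factor \<open>(n k)\<^sup>2\<close> in the
    estimate on \<open>U k\<close> below and leaves an error of \<open>1 / n k\<close>.\<close>
  have "\<exists>s. s \<in> dom \<and> (\<forall>x. 0 \<le> s x) \<and> ldist M (U k) (\<lambda>x. 0) s < 1 / n k ^ 3 \<and> q (\<lambda>x. r x - s x) \<le> c" for k
    using s[OF Uf, of "1 / n k ^ 3" k] n[of k] by auto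
  then obtain s where sd: "\<And>k. s k \<in> dom" and s0: "\<And>k x. 0 \<le> s k x"
    and sl: "\<And>k. ldist M (U k) (\<lambda>x. 0) (s k) < 1 / n k ^ 3" and sq: "\<And>k. q (\<lambda>x. r x - s k x) \<le> c"
    by metis
  define t where "t k = (\<lambda>x. max 0 (r x - s k x))" for k
  have t: "t k \<in> dom" "q (t k) \<le> c" for k
    unfolding t_def using pos_part[OF dom_add_diff(2)[OF r sd]] sq[of k] by (auto intro: order_trans)
  have sm [measurable]: "s k \<in> borel_measurable M" for k
    using sd by (rule dom_measurable)
  have tm [measurable]: "t k \<in> borel_measurable M" for k
    using t(1) by (rule dom_measurable)
  \<comment> \<open>The part of \<open>r\<close> outside \<open>U k\<close>. It controls the error
    there without any information on \<open>s k\<close>, since \<open>min (r x) (s k x)\<close>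
    never exceeds \<open>r x\<close>.\<close>
  define a where "a k = (\<lambda>x. if 1 / n k \<le> r x \<and> r x \<le> n k then 0 else r x)" for k
  have am: "a k \<in> borel_measurable M" for k
    unfolding a_def by measurable
  have a2: "a k \<in> sq.dom M" for k
    using r2(1) am by (rule sq_dom_dominated) (auto simp: a_def)
  have "(\<lambda>k. sq.q M (a k)) \<longlonglongrightarrow> 0"
  proof (rule sq_dominated_convergence[OF r2(1) am])
    show "\<bar>a k x\<bar> \<le> \<bar>r x\<bar>" for k x
      by (auto simp: a_def)
    show "(\<lambda>k. a k x) \<longlonglongrightarrow> 0" for x
    proof (cases "r x = 0")
      case True
      then have "a k x = 0" for k
        by (simp add: a_def)
      then show ?thesis
        by simp
    next
      case False
      then have rx: "0 < r x"
        using r0[of x] by simp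
      obtain N where N: "max (r x) (1 / r x) < real N"
        using reals_Archimedean2 by blast
      have "a k x = 0" if "k \<ge> N" for k
      proof -
        have "r x \<le> n k" "1 / r x \<le> n k"
          using N that by (auto simp: n_def)
        then show ?thesis
          using rx n[of k] by (auto simp: a_def field_simps)
      qed
      then have "\<forall>\<^sub>F k in sequentially. a k x = 0"
        unfolding eventually_sequentially by blast
      then show ?thesis
        by (rule tendsto_eventually)
    qed
  qed
  then have "(\<lambda>k. sq.q M (a k) + 1 / n k) \<longlonglongrightarrow> 0 + 0"
    unfolding n_def by (intro tendsto_add LIMSEQ_Suc[OF lim_1_over_n])
  then have lim: "(\<lambda>k. sq.q M (a k) + 1 / n k) \<longlonglongrightarrow> 0"
    by simp
  have bound: "sq.q M (\<lambda>x. t k x - r x) \<le> sq.q M (a k) + 1 / n k" for k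
  proof -
    let ?l = "\<lambda>x. indicat_real (U k) x *\<^sub>R min \<bar>0 - s k x\<bar> 1"
    have li: "integrable M ?l"
      using ldist_integrable[OF Uf, of "\<lambda>x. 0" "s k"] by (simp add: set_integrable_def)
    have ai: "integrable M (\<lambda>x. (a k x)\<^sup>2)"
      using a2 by (simp add: sq_dom_iff)
    have "t k x - r x = - min (r x) (s k x)" for x
      by (simp add: t_def)
    then have pt: "(t k x - r x)\<^sup>2 \<le> (a k x)\<^sup>2 + (n k)\<^sup>2 * ?l x" if x: "x \<in> space M" for x
    proof (cases "x \<in> U k")
      case True
      \<comment> \<open>If \<open>s k x\<close> is at most \<open>1\<close> the truncation is
        inactive and \<open>n k\<close> is at least \<open>1\<close>; otherwise the right side is
        \<open>n k\<close>, which bounds \<open>r\<close> on \<open>U k\<close>. Multiplying by the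
        bound \<open>n k\<close> for the minimum itself controls the square by the truncated
        distance.\<close>
      have "min (r x) (s k x) \<le> n k * min (s k x) 1"
      proof (cases "s k x \<le> 1")
        case True
        then show ?thesis
          using n[of k] mult_right_mono[OF n[of k] s0[of k x]] by simp
      next
        case False
        then show ?thesis
          using \<open>x \<in> U k\<close> by (simp add: U_def min.coboundedI1)
      qed
      moreover have "0 \<le> min (r x) (s k x)" "min (r x) (s k x) \<le> n k"
        using True r0 s0 by (auto simp: U_def min.coboundedI1)
      ultimately have "min (r x) (s k x) * min (r x) (s k x) \<le> n k * (n k * min (s k x) 1)"
        using n[of k] by (intro mult_mono) auto
      then show ?thesis
        using True s0[of k x] \<open>\<And>x. t k x - r x = - min (r x) (s k x)\<close>
        by (simp add: power2_eq_square mult.assoc a_def U_def)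
    next
      case False
      have "\<bar>min (r x) (s k x)\<bar> \<le> \<bar>r x\<bar>"
        using r0[of x] s0[of k x] by auto
      then have "(min (r x) (s k x))\<^sup>2 \<le> (r x)\<^sup>2"
        by (simp add: abs_le_square_iff)
      then show ?thesis
        using False x \<open>\<And>x. t k x - r x = - min (r x) (s k x)\<close> by (auto simp: a_def U_def)
    qed
    have "sq.q M (\<lambda>x. t k x - r x) = (LINT x|M. (t k x - r x)\<^sup>2)"
      by (intro sq_q_eq) measurable
    also have "\<dots> \<le> (LINT x|M. (a k x)\<^sup>2 + (n k)\<^sup>2 * ?l x)"
    proof (rule integral_mono)
      show "integrable M (\<lambda>x. (t k x - r x)\<^sup>2)"
        using sq.dom_add_diff(2)[OF dom_sq_dom[OF t(1)] r2(1)] by (simp add: sq_dom_iff)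
      show "integrable M (\<lambda>x. (a k x)\<^sup>2 + (n k)\<^sup>2 * ?l x)"
        by (intro Bochner_Integration.integrable_add integrable_mult_right ai li)
    qed (rule pt)
    also have "\<dots> = (LINT x|M. (a k x)\<^sup>2) + (n k)\<^sup>2 * (LINT x|M. ?l x)"
      using ai li by (subst Bochner_Integration.integral_add) auto
    also have "\<dots> = sq.q M (a k) + (n k)\<^sup>2 * ldist M (U k) (\<lambda>x. 0) (s k)"
      using am by (simp add: sq_q_eq ldist_def set_lebesgue_integral_def)
    also have "(n k)\<^sup>2 * ldist M (U k) (\<lambda>x. 0) (s k) \<le> (n k)\<^sup>2 * (1 / n k ^ 3)"
      using sl[of k] by (intro mult_left_mono) auto
    also have "(n k)\<^sup>2 * (1 / n k ^ 3) = 1 / n k"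
      using n[of k] by (simp add: power2_eq_square power3_eq_cube)
    finally show ?thesis
      by simp
  qed
  have "(\<lambda>k. sq.q M (\<lambda>x. t k x - r x)) \<longlonglongrightarrow> 0"
    using bound by (intro tendsto_sandwich[OF _ _ tendsto_const lim]) auto
  then show ?thesis
    by (rule lsc_L2(2)[OF r2(1) t])
qed

text \<open>The difference \<open>d - v\<close> is split into its positive and negative parts \<open>p\<close>, \<open>n\<close> before minimizing,
  because \<open>q_le_of_nonneg_perturbation\<close> needs signs and a \<open>q\<close>-Cauchy property of \<open>d - v\<close> would not
  obviously pass to the positive part.\<close>

lemma lsc_L0:
  assumes v: "v \<in> dom"
    and approx: "\<And>U \<delta>. U \<in> fmeasurable M \<Longrightarrow> 0 < \<delta> \<Longrightarrow> \<exists>d\<in>dom. ldist M U v d < \<delta> \<and> q d \<le> c"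
  shows "q v \<le> c"
proof -
  define I where "I = {(U, \<delta>). U \<in> fmeasurable M \<and> (0::real) < \<delta>}"
  \<comment> \<open>All conditions on a pair are kept under midpoints once the tolerance is halved
    beforehand, which the minimization requires. Minimizing the sum \<open>e\<close> controls both
    components at once.\<close>
  define R where "R i = {(p, n). p \<in> dom \<and> n \<in> dom \<and> (\<forall>x. 0 \<le> p x) \<and> (\<forall>x. 0 \<le> n x) \<and>
      ldist M (fst i) (\<lambda>x. 0) p < snd i \<and> ldist M (fst i) (\<lambda>x. 0) n < snd i \<and>
      q (\<lambda>x. v x + (p x - n x)) \<le> c}" for i
  define e where "e pn = q (fst pn) + q (snd pn)" for pn :: "('a \<Rightarrow> real) \<times> ('a \<Rightarrow> real)"
  have vm: "v \<in> borel_measurable M"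
    using v by (rule dom_measurable)
  have c0: "0 \<le> c"
  proof -
    obtain d where "d \<in> dom" "q d \<le> c"
      using approx[of "{}" 1] by auto
    then show ?thesis
      using q_nonneg[of d] by linarith
  qed
  have Ine: "I \<noteq> {}"
  proof -
    have "({}, 1) \<in> I"
      by (simp add: I_def)
    then show ?thesis
      by blast
  qed
  have e0: "0 \<le> e pn" for pn
    by (simp add: e_def)
  \<comment> \<open>Each part of \<open>d - v\<close> has energy at most \<open>q (d - v)\<close>,
    and the parallelogram law bounds that by \<open>2 * c + 2 * q v\<close>.\<close>
  have "\<exists>pn\<in>R i. e pn \<le> 4 * c + 4 * q v" if i: "i \<in> I" for i
  proof -
    obtain U \<delta> where U: "i = (U, \<delta>)" "U \<in> fmeasurable M" "0 < \<delta>"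
      using i by (auto simp: I_def)
    obtain d where d: "d \<in> dom" "ldist M U v d < \<delta>" "q d \<le> c"
      using approx[OF U(2,3)] by blast
    let ?p = "\<lambda>x. max 0 (d x - v x)" and ?n = "\<lambda>x. max 0 (v x - d x)"
    note p = pos_part[OF dom_add_diff(2)[OF d(1) v]] and n = pos_part[OF dom_add_diff(2)[OF v d(1)]]
    have dm: "d \<in> borel_measurable M"
      using d(1) by (rule dom_measurable)
    have "ldist M U (\<lambda>x. 0) ?p \<le> ldist M U v d" "ldist M U (\<lambda>x. 0) ?n \<le> ldist M U v d"
      by (rule ldist_le[OF U(2) borel_measurable_const p(1)[THEN dom_measurable] vm dm], simp)
        (rule ldist_le[OF U(2) borel_measurable_const n(1)[THEN dom_measurable] vm dm], simp)
    moreover have "(\<lambda>x. v x + (?p x - ?n x)) = d"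
      by (auto simp: max_def)
    ultimately have "(?p, ?n) \<in> R i"
      using p(1) n(1) d U(1) by (auto simp: R_def)
    moreover have "e (?p, ?n) \<le> 4 * c + 4 * q v"
      using p(2) n(2) q_para[OF d(1) v] q_nonneg[of "\<lambda>x. d x + v x"] d(3) q_minus_commute[OF d(1) v]
      unfolding e_def fst_conv snd_conv by linarith
    ultimately show ?thesis
      by blast
  qed
  then obtain m where m1: "\<And>i \<tau>. i \<in> I \<Longrightarrow> 0 < \<tau> \<Longrightarrow> \<exists>x\<in>R i. e x < m + \<tau>"
    and m2: "\<And>\<tau>. 0 < \<tau> \<Longrightarrow> \<exists>i\<in>I. \<forall>x\<in>R i. m - \<tau> < e x"
    using sup_inf_obtain[OF Ine, of e R "4 * c + 4 * q v"] e0 by metis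
  have "sqrt (q v) \<le> sqrt c + 2 * sqrt (8 * \<tau>)" if \<tau>: "0 < \<tau>" for \<tau>
  proof -
    obtain U \<delta> where U: "U \<in> fmeasurable M" "0 < \<delta>" and mU: "\<And>x. x \<in> R (U, \<delta>) \<Longrightarrow> m - \<tau> < e x"
      using m2[OF \<tau>] by (auto simp: I_def)
    \<comment> \<open>The tolerance is \<open>\<delta> / 2\<close> because the midpoint of this pair
      with a later one must lie in \<open>R (U, \<delta>)\<close>, where the lower bound
      \<open>m - \<tau>\<close> is valid.\<close>
    obtain p n where pn: "(p, n) \<in> R (U, \<delta> / 2)" "e (p, n) < m + \<tau>"
      using m1[of "(U, \<delta> / 2)" \<tau>] U \<tau> by (auto simp: I_def)
    have pnd: "p \<in> dom" "n \<in> dom" and pn0: "\<And>x. 0 \<le> p x" "\<And>x. 0 \<le> n x"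
      and pnl: "ldist M U (\<lambda>x. 0) p < \<delta> / 2" "ldist M U (\<lambda>x. 0) n < \<delta> / 2"
      and pnc: "q (\<lambda>x. v x + (p x - n x)) \<le> c"
      using pn(1) by (auto simp: R_def)
    have near: "\<exists>p' n'. p' \<in> dom \<and> n' \<in> dom \<and> (\<forall>x. 0 \<le> p' x) \<and> (\<forall>x. 0 \<le> n' x) \<and>
        ldist M V (\<lambda>x. 0) p' < \<eta> \<and> ldist M V (\<lambda>x. 0) n' < \<eta> \<and>
        q (\<lambda>x. p x - p' x) \<le> 8 * \<tau> \<and> q (\<lambda>x. n x - n' x) \<le> 8 * \<tau>"
      if V: "V \<in> fmeasurable M" "0 < \<eta>" for V \<eta>
    proof -
      have UV: "U \<union> V \<in> fmeasurable M"
        using U V by auto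
      have sub: "U \<in> sets M" "V \<in> sets M" "U \<subseteq> U \<union> V" "V \<subseteq> U \<union> V"
        using U V by auto
      \<comment> \<open>The later pair is small on \<open>U\<close>, so that midpoints satisfy the
        lower bound, and also on the arbitrary \<open>V\<close>, so that it is an admissible
        perturbation for \<open>q_le_of_nonneg_perturbation\<close>.\<close>
      obtain p' n' where pn': "(p', n') \<in> R (U \<union> V, min (\<delta> / 2) \<eta>)" "e (p', n') < m + \<tau>"
        using m1[of "(U \<union> V, min (\<delta> / 2) \<eta>)" \<tau>] UV U V \<tau> by (auto simp: I_def)
      have pnd': "p' \<in> dom" "n' \<in> dom" and pn0': "\<And>x. 0 \<le> p' x" "\<And>x. 0 \<le> n' x"
        and pnl': "ldist M (U \<union> V) (\<lambda>x. 0) p' < min (\<delta> / 2) \<eta>" "ldist M (U \<union> V) (\<lambda>x. 0) n' < min (\<delta> / 2) \<eta>"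
        and pnc': "q (\<lambda>x. v x + (p' x - n' x)) \<le> c"
        using pn'(1) by (auto simp: R_def)
      note meas = pnd[THEN dom_measurable] pnd'[THEN dom_measurable]
      note mono = ldist_mono_set[OF UV sub(1,3) borel_measurable_const[where c = 0]]
        ldist_mono_set[OF UV sub(2,4) borel_measurable_const[where c = 0]]
      let ?p = "\<lambda>x. (p x + p' x) / 2" and ?n = "\<lambda>x. (n x + n' x) / 2"
      have mid: "ldist M U (\<lambda>x. 0) (\<lambda>x. (a x + b x) / 2) < \<delta>"
        if "a \<in> borel_measurable M" "b \<in> borel_measurable M" "ldist M U (\<lambda>x. 0) a < \<delta> / 2"
          "ldist M (U \<union> V) (\<lambda>x. 0) b < min (\<delta> / 2) \<eta>" for a b
      proof -
        have "ldist M U (\<lambda>x. 0) (\<lambda>x. (a x + b x) / 2) \<le> ldist M U (\<lambda>x. 0) a + ldist M U (\<lambda>x. 0) b"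
          using that by (intro ldist_le_add U) (auto simp: min_def)
        then show ?thesis
          using that mono(1)[OF that(2)] by linarith
      qed
      \<comment> \<open>The constraint is affine in the pair, so the midpoint of the pairs
        corresponds to the midpoint of two functions of energy at most \<open>c\<close>.\<close>
      have "(\<lambda>x. v x + (?p x - ?n x)) = (\<lambda>x. ((v x + (p x - n x)) + (v x + (p' x - n' x))) / 2)"
        by (auto simp: field_simps)
      moreover have "q (\<lambda>x. ((v x + (p x - n x)) + (v x + (p' x - n' x))) / 2) \<le> c"
        by (intro q_mid_le dom_add_diff v pnd pnd' pnc pnc')
      ultimately have "(?p, ?n) \<in> R (U, \<delta>)"
        using pn0 pn0' mid[OF meas(1,3) pnl(1) pnl'(1)] mid[OF meas(2,4) pnl(2) pnl'(2)]
          q_mid(2)[OF pnd(1) pnd'(1)] q_mid(2)[OF pnd(2) pnd'(2)]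
        by (auto simp: R_def)
      then have "m - \<tau> < q ?p + q ?n"
        using mU by (auto simp: e_def)
      \<comment> \<open>Adding the midpoint identities for both components gives
        \<open>4 * (m + \<tau>) - 4 * (m - \<tau>) = 8 * \<tau>\<close>.\<close>
      then have "q (\<lambda>x. p x - p' x) + q (\<lambda>x. n x - n' x) \<le> 8 * \<tau>"
        using q_mid(1)[OF pnd(1) pnd'(1)] q_mid(1)[OF pnd(2) pnd'(2)] pn(2) pn'(2)
        unfolding e_def fst_conv snd_conv by linarith
      then have "q (\<lambda>x. p x - p' x) \<le> 8 * \<tau>" "q (\<lambda>x. n x - n' x) \<le> 8 * \<tau>"
        using q_nonneg[of "\<lambda>x. p x - p' x"] q_nonneg[of "\<lambda>x. n x - n' x"] by linarith+
      moreover have "ldist M V (\<lambda>x. 0) p' < \<eta>" "ldist M V (\<lambda>x. 0) n' < \<eta>"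
        using mono(2)[OF meas(3)] mono(2)[OF meas(4)] pnl' by linarith+
      ultimately show ?thesis
        using pnd' pn0' by blast
    qed
    \<comment> \<open>The functions \<open>p'\<close> serve as the perturbations of
      \<open>p\<close>: they are nonnegative, as small as desired on any set of finite measure, and
      \<open>p - p'\<close> has energy at most \<open>8 * \<tau>\<close>.\<close>
    have "q p \<le> 8 * \<tau>"
      by (rule q_le_of_nonneg_perturbation[OF pnd(1) pn0(1)]) (use near in blast)
    moreover have "q n \<le> 8 * \<tau>"
      by (rule q_le_of_nonneg_perturbation[OF pnd(2) pn0(2)]) (use near in blast)
    ultimately have small: "sqrt (q p) \<le> sqrt (8 * \<tau>)" "sqrt (q n) \<le> sqrt (8 * \<tau>)" "sqrt (q (\<lambda>x. v x + (p x - n x))) \<le> sqrt c"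
      using pnc by simp_all
    have 1: "sqrt (q v) \<le> sqrt (q (\<lambda>x. v x + (p x - n x))) + sqrt (q (\<lambda>x. n x - p x))"
      using sqrt_q_triangle[OF dom_add_diff(1)[OF v dom_add_diff(2)[OF pnd]] dom_add_diff(2)[OF pnd(2,1)]]
      by simp
    have 2: "sqrt (q (\<lambda>x. n x - p x)) \<le> sqrt (q n) + sqrt (q p)"
      using sqrt_q_triangle_diff[OF pnd(2,1) dom_zero] q_minus_commute[OF dom_zero pnd(1)] by simp
    show ?thesis
      using 1 2 small by linarith
  qed
  note bound = this
  \<comment> \<open>This choice of \<open>\<tau>\<close> makes \<open>2 * sqrt (8 * \<tau>)\<close>
    equal to \<open>\<epsilon>\<close>.\<close>
  have "sqrt (q v) \<le> sqrt c + \<epsilon>" if "0 < \<epsilon>" for \<epsilon>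
    using bound[of "(\<epsilon> / 2)\<^sup>2 / 8"] that by simp
  then have "sqrt (q v) \<le> sqrt c"
    by (rule field_le_epsilon)
  then show ?thesis
    by simp
qed

end

section \<open>Completeness of the space of measurable functions\<close>

lemma ldist_eq_0_AE:
  assumes U: "U \<in> fmeasurable M" and meas: "f \<in> borel_measurable M" "g \<in> borel_measurable M"
    and zero: "ldist M U f g = 0"
  shows "AE x in M. x \<in> U \<longrightarrow> f x = g x"
proof -
  have "AE x in M. indicat_real U x *\<^sub>R min \<bar>f x - g x\<bar> 1 = 0"
    using zero ldist_integrable[OF U meas] unfolding ldist_def set_lebesgue_integral_def set_integrable_def
    by (subst (asm) integral_nonneg_eq_0_iff_AE) auto
  then show ?thesis
    by eventually_elim (auto simp: indicator_def min_def split: if_splits)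
qed

text \<open>The terms of a summable series are eventually below \<open>1\<close>, where the
  truncation is inactive, so the increments themselves are absolutely summable.\<close>

lemma convergent_if_summable_truncated:
  fixes w :: "nat \<Rightarrow> real"
  assumes "summable (\<lambda>k. min \<bar>w k - w (Suc k)\<bar> 1)"
  shows "convergent w"
proof -
  have "\<forall>\<^sub>F k in sequentially. min \<bar>w k - w (Suc k)\<bar> 1 < 1"
    by (rule order_tendstoD(2)[OF summable_LIMSEQ_zero[OF assms]]) simp
  then have "\<forall>\<^sub>F k in sequentially. norm (w (Suc k) - w k) \<le> min \<bar>w k - w (Suc k)\<bar> 1"
    by eventually_elim (auto simp: min_def split: if_splits)
  then have "summable (\<lambda>k. w (Suc k) - w k)"
    by (rule summable_comparison_test_ev[OF _ assms])
  then have "convergent (\<lambda>n. \<Sum>k<n. w (Suc k) - w k)"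
    by (simp add: summable_iff_convergent)
  then have "convergent (\<lambda>n. w 0 + (\<Sum>k<n. w (Suc k) - w k))"
    by (intro convergent_add convergent_const)
  then show ?thesis
    by (simp add: sum_lessThan_telescope)
qed

text \<open>The Riesz-Fischer argument for a filter: a sequence picked at geometric scales converges
  almost everywhere on \<open>U\<close>, and the Cauchy property carries the convergence from the
  sequence over to the filter.\<close>

lemma ldist_complete_on:
  assumes U: "U \<in> fmeasurable M" and G: "G \<noteq> bot" "\<forall>\<^sub>F g in G. g \<in> borel_measurable M"
    and cauchy: "\<And>r. 0 < r \<Longrightarrow> \<exists>P. eventually P G \<and> (\<forall>f g. P f \<longrightarrow> P g \<longrightarrow> ldist M U f g < r)"
  shows "\<exists>h\<in>borel_measurable M. \<forall>r>0. \<forall>\<^sub>F g in G. ldist M U h g < r"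
proof -
  have [measurable]: "U \<in> sets M"
    using U by auto
  have "\<exists>P. eventually P G \<and> (\<forall>f g. P f \<longrightarrow> P g \<longrightarrow> ldist M U f g < (1 / 2) ^ k)" for k :: nat
    by (rule cauchy) simp
  then obtain P where P: "\<And>k. eventually (P k) G"
    and Pd: "\<And>k f g. P k f \<Longrightarrow> P k g \<Longrightarrow> ldist M U f g < (1 / 2) ^ k"
    by metis
  \<comment> \<open>Meeting all earlier scales as well puts \<open>w k\<close> and
    \<open>w (Suc k)\<close> in the same set \<open>P k\<close>, so their distance is below
    \<open>(1 / 2) ^ k\<close>.\<close>
  have "\<exists>w. w \<in> borel_measurable M \<and> (\<forall>j\<in>{..k}. P j w)" for k
  proof -
    have "\<forall>\<^sub>F w in G. \<forall>j\<in>{..k}. P j w"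
      using P by (intro eventually_ball_finite) auto
    then have "\<forall>\<^sub>F w in G. w \<in> borel_measurable M \<and> (\<forall>j\<in>{..k}. P j w)"
      using G(2) by eventually_elim blast
    then show ?thesis
      using eventually_happens'[OF G(1)] by blast
  qed
  then obtain w where w [measurable]: "\<And>k. w k \<in> borel_measurable M" and wP: "\<And>k j. j \<le> k \<Longrightarrow> P j (w k)"
    by (metis atMost_iff)
  let ?d = "\<lambda>k x. indicat_real U x * min \<bar>w k x - w (Suc k) x\<bar> 1"
  have di: "integrable M (?d k)" and dl: "(LINT x|M. ?d k x) \<le> (1 / 2) ^ k" for k
    using ldist_integrable[OF U w w, of k "Suc k"] Pd[of k "w k" "w (Suc k)"] wP[of k]
    by (auto simp: set_integrable_def ldist_def set_lebesgue_integral_def)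
  have "(\<integral>\<^sup>+x. (\<Sum>k. ennreal (?d k x)) \<partial>M) = (\<Sum>k. \<integral>\<^sup>+x. ennreal (?d k x) \<partial>M)"
    by (rule nn_integral_suminf) measurable
  also have "\<dots> = (\<Sum>k. ennreal (LINT x|M. ?d k x))"
    using di by (subst nn_integral_eq_integral) auto
  also have "\<dots> \<le> (\<Sum>k. ennreal ((1 / 2) ^ k))"
    using dl by (intro suminf_le ennreal_leI) auto
  also have "\<dots> < \<infinity>"
    using summable_geometric[of "1 / 2 :: real"] by (subst suminf_ennreal2) auto
  finally have "AE x in M. (\<Sum>k. ennreal (?d k x)) \<noteq> \<infinity>"
    by (intro nn_integral_noteq_infinite) auto
  then have ae: "AE x in M. x \<in> U \<longrightarrow> convergent (\<lambda>k. w k x)"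
  proof eventually_elim
    case (elim x)
    show ?case
    proof
      assume "x \<in> U"
      then have "summable (\<lambda>k. min \<bar>w k x - w (Suc k) x\<bar> 1)"
        using elim by (intro summable_suminf_not_top) auto
      then show "convergent (\<lambda>k. w k x)"
        by (rule convergent_if_summable_truncated)
    qed
  qed
  \<comment> \<open>Where the sequence diverges, \<open>lim\<close> has an arbitrary value; on
    \<open>U\<close> this happens only in a null set.\<close>
  define h where "h x = lim (\<lambda>k. w k x)" for x
  have h [measurable]: "h \<in> borel_measurable M"
    unfolding h_def by measurable
  have "(\<lambda>k. LINT x|M. indicat_real U x *\<^sub>R min \<bar>h x - w k x\<bar> 1) \<longlonglongrightarrow> (LINT x|M. 0)"
  proof (rule integral_dominated_convergence)
    show "integrable M (indicat_real U)"
      using U by (simp add: fmeasurable_iff)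
    show "AE x in M. (\<lambda>k. indicat_real U x *\<^sub>R min \<bar>h x - w k x\<bar> 1) \<longlonglongrightarrow> 0"
      using ae
    proof eventually_elim
      case (elim x)
      show ?case
      proof (cases "x \<in> U")
        case True
        then have "(\<lambda>k. w k x) \<longlonglongrightarrow> h x"
          using elim by (simp add: h_def convergent_LIMSEQ_iff)
        then have "(\<lambda>k. min \<bar>h x - w k x\<bar> 1) \<longlonglongrightarrow> min \<bar>h x - h x\<bar> 1"
          by (intro tendsto_intros)
        then show ?thesis
          using True by simp
      qed simp
    qed
  qed (auto simp: indicator_def)
  then have lim: "(\<lambda>k. ldist M U h (w k)) \<longlonglongrightarrow> 0"
    by (simp add: ldist_def set_lebesgue_integral_def)
  have "\<forall>\<^sub>F g in G. ldist M U h g < r" if r: "0 < r" for r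
  proof -
    have "\<forall>\<^sub>F k in sequentially. ldist M U h (w k) < r / 2"
      using r by (intro order_tendstoD(2)[OF lim]) simp
    moreover have "(\<lambda>k. (1 / 2 :: real) ^ k) \<longlonglongrightarrow> 0"
      by (rule LIMSEQ_power_zero) simp
    then have "\<forall>\<^sub>F k in sequentially. (1 / 2 :: real) ^ k < r / 2"
      using r by (intro order_tendstoD(2)) auto
    ultimately have "\<forall>\<^sub>F k in sequentially. ldist M U h (w k) < r / 2 \<and> (1 / 2 :: real) ^ k < r / 2"
      by (rule eventually_conj)
    then obtain k where k: "ldist M U h (w k) < r / 2" "(1 / 2 :: real) ^ k < r / 2"
      by (auto simp: eventually_sequentially)
    show ?thesis
      using P[of k] G(2)
    proof eventually_elim
      case (elim g)
      then show ?case
        using ldist_triangle[OF U h elim(2) w[of k]] Pd[OF wP[OF order_refl] elim(1)] k by linarith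
    qed
  qed
  then show ?thesis
    using h by blast
qed

text \<open>A real is recovered from its rational lower cut. With \<open>- \<infinity>\<close> off
  the cut, the index set no longer depends on the point, so in the gluing below the supremum is a
  countable one of measurable functions.\<close>

lemma SUP_rat_below:
  "(SUP q\<in>(UNIV :: rat set). if of_rat q \<le> y then ereal (of_rat q) else - \<infinity>) = ereal y"
proof (rule antisym)
  show "ereal y \<le> (SUP q\<in>(UNIV :: rat set). if of_rat q \<le> y then ereal (of_rat q) else - \<infinity>)"
  proof (subst le_SUP_iff, intro allI impI)
    fix z assume "z < ereal y"
    then obtain r where r: "z < ereal r" "ereal r < ereal y"
      using ereal_dense2 by blast
    then obtain q :: rat where "r < of_rat q" "of_rat q < y"
      using of_rat_dense[of r y] by auto
    then have "z < (if of_rat q \<le> y then ereal (of_rat q) else - \<infinity>)"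
      using r(1) by (auto intro: less_trans)
    then show "\<exists>q\<in>UNIV. z < (if of_rat q \<le> y then ereal (of_rat q) else - \<infinity>)"
      by blast
  qed
  show "(SUP q\<in>(UNIV :: rat set). if of_rat q \<le> y then ereal (of_rat q) else - \<infinity>) \<le> ereal y"
    by (rule SUP_least) simp
qed

text \<open>\<open>S q\<close> is an essential supremum of the sets \<open>{x \<in> U. q \<le> h U x}\<close>, and the glued function
  is \<open>x \<mapsto> sup {q. x \<in> S q}\<close>.\<close>

lemma localizable_glue:
  assumes loc: "localizable M"
    and h: "\<And>U. U \<in> fmeasurable M \<Longrightarrow> h U \<in> borel_measurable M"
    and agree: "\<And>U V. U \<in> fmeasurable M \<Longrightarrow> V \<in> fmeasurable M \<Longrightarrow>
      AE x in M. x \<in> U \<longrightarrow> x \<in> V \<longrightarrow> h U x = h V x"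
  shows "\<exists>f\<in>borel_measurable M. \<forall>U\<in>fmeasurable M. AE x in M. x \<in> U \<longrightarrow> f x = (h U x :: real)"
proof -
  define A where "A q U = {x \<in> space M. x \<in> U \<and> of_rat q \<le> h U x}" for q :: rat and U
  have A: "A q U \<in> sets M" if "U \<in> fmeasurable M" for q U
    unfolding A_def using h[OF that] that by measurable
  have "\<exists>S. is_ess_sup M (A q ` fmeasurable M) S" for q
    using loc A unfolding localizable_def by (simp add: image_subset_iff)
  then obtain S where S: "\<And>q. is_ess_sup M (A q ` fmeasurable M) (S q)"
    by metis
  have Sm [measurable]: "S q \<in> sets M" for q
    using S[of q] by (simp add: is_ess_sup_def)
  have S_iff: "AE x in M. x \<in> U \<longrightarrow> (x \<in> S q \<longleftrightarrow> of_rat q \<le> h U x)" if U: "U \<in> fmeasurable M" for U q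
  proof -
    have [measurable]: "U \<in> sets M" "h U \<in> borel_measurable M"
      using U h by auto
    \<comment> \<open>The complement of \<open>?B\<close> contains every \<open>A q V\<close> up to
      a null set, by agreement on overlaps. Minimality of the essential supremum then keeps
      \<open>S q\<close> off \<open>?B\<close> almost everywhere.\<close>
    let ?B = "{x \<in> space M. x \<in> U \<and> h U x < of_rat q}"
    have "emeasure M (A q U - S q) = 0"
      using S[of q] U by (auto simp: is_ess_sup_def)
    then have 1: "AE x in M. x \<notin> A q U - S q"
      using A[OF U] by (intro AE_not_in) (auto simp: null_sets_def)
    have "emeasure M (A q V - (space M - ?B)) = 0" if V: "V \<in> fmeasurable M" for V
    proof -
      have "A q V - (space M - ?B) = {x \<in> space M. x \<in> V \<and> x \<in> U \<and> of_rat q \<le> h V x \<and> h U x < of_rat q}"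
        by (auto simp: A_def)
      moreover have "emeasure M \<dots> = 0"
        by (rule emeasure_eq_0_AE, use agree[OF U V] in eventually_elim) auto
      ultimately show ?thesis
        by simp
    qed
    moreover have "space M - ?B \<in> sets M"
      by measurable
    ultimately have "emeasure M (S q - (space M - ?B)) = 0"
      using S[of q] unfolding is_ess_sup_def by blast
    then have 2: "AE x in M. x \<notin> S q - (space M - ?B)"
      by (intro AE_not_in) (auto simp: null_sets_def)
    show ?thesis
      using 1 2 AE_space by eventually_elim (auto simp: A_def not_le)
  qed
  \<comment> \<open>Infinite suprema are sent to \<open>0\<close>; in each set of finite measure
    they occur only on a null set.\<close>
  define f where "f x = real_of_ereal (SUP q\<in>UNIV. if x \<in> S q then ereal (of_rat q) else - \<infinity>)" for x
  have "f \<in> borel_measurable M"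
    unfolding f_def by measurable
  moreover have "AE x in M. x \<in> U \<longrightarrow> f x = h U x" if U: "U \<in> fmeasurable M" for U
  proof -
    \<comment> \<open>Countability of the rationals allows one exceptional null set for all
      \<open>q\<close>.\<close>
    have "AE x in M. \<forall>q. x \<in> U \<longrightarrow> (x \<in> S q \<longleftrightarrow> of_rat q \<le> h U x)"
      by (subst AE_all_countable) (use S_iff[OF U] in blast)
    then show ?thesis
    proof eventually_elim
      case (elim x)
      show ?case
      proof
        assume "x \<in> U"
        with elim have "(x \<in> S q) = (of_rat q \<le> h U x)" for q
          by blast
        then have "f x = real_of_ereal
            (SUP q\<in>(UNIV :: rat set). if of_rat q \<le> h U x then ereal (of_rat q) else - \<infinity>)"
          by (simp only: f_def)
        then show "f x = h U x"
          by (simp only: SUP_rat_below real_of_ereal.simps)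
      qed
    qed
  qed
  ultimately show ?thesis
    by blast
qed

text \<open>The limits on \<open>U\<close> and \<open>V\<close> agree almost everywhere on the
  intersection, being limits of the same nontrivial filter there. The family of all sets of finite
  measure may be uncountable, which is where gluing by essential suprema is required.\<close>

lemma L0_complete:
  assumes loc: "localizable M" and G: "G \<noteq> bot" "\<forall>\<^sub>F g in G. g \<in> borel_measurable M"
    and cauchy: "\<And>U r. U \<in> fmeasurable M \<Longrightarrow> 0 < r \<Longrightarrow>
      \<exists>P. eventually P G \<and> (\<forall>f g. P f \<longrightarrow> P g \<longrightarrow> ldist M U f g < r)"
  shows "\<exists>f\<in>borel_measurable M. \<forall>U\<in>fmeasurable M. \<forall>r>0. \<forall>\<^sub>F g in G. ldist M U f g < r"
proof -
  have "\<exists>h. h \<in> borel_measurable M \<and> (\<forall>r>0. \<forall>\<^sub>F g in G. ldist M U h g < r)" if "U \<in> fmeasurable M" for U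
    using ldist_complete_on[OF that G cauchy[OF that]] by blast
  then obtain h where h: "\<And>U. U \<in> fmeasurable M \<Longrightarrow> h U \<in> borel_measurable M"
    and hl: "\<And>U r. U \<in> fmeasurable M \<Longrightarrow> 0 < r \<Longrightarrow> \<forall>\<^sub>F g in G. ldist M U (h U) g < r"
    by metis
  have agree: "AE x in M. x \<in> U \<longrightarrow> x \<in> V \<longrightarrow> h U x = h V x"
    if U: "U \<in> fmeasurable M" and V: "V \<in> fmeasurable M" for U V
  proof -
    have UV: "U \<inter> V \<in> fmeasurable M" "U \<inter> V \<in> sets M"
      using U V by auto
    have "ldist M (U \<inter> V) (h U) (h V) \<le> 0 + r" if r: "0 < r" for r
    proof -
      have "\<forall>\<^sub>F g in G. ldist M U (h U) g < r / 2 \<and> ldist M V (h V) g < r / 2 \<and> g \<in> borel_measurable M"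
        using hl[OF U, of "r / 2"] hl[OF V, of "r / 2"] G(2) r by (auto intro: eventually_conj)
      then obtain g where g: "ldist M U (h U) g < r / 2" "ldist M V (h V) g < r / 2" "g \<in> borel_measurable M"
        using eventually_happens'[OF G(1)] by blast
      show ?thesis
        using ldist_triangle[OF UV(1) h[OF U] h[OF V] g(3)] ldist_commute[of M "U \<inter> V" g "h V"]
          ldist_mono_set[OF U UV(2) _ h[OF U] g(3)] ldist_mono_set[OF V UV(2) _ h[OF V] g(3)] g(1,2)
        by simp
    qed
    then have "ldist M (U \<inter> V) (h U) (h V) \<le> 0"
      by (rule field_le_epsilon)
    then have "ldist M (U \<inter> V) (h U) (h V) = 0"
      using ldist_nonneg[of M "U \<inter> V" "h U" "h V"] by simp
    from ldist_eq_0_AE[OF UV(1) h[OF U] h[OF V] this] show ?thesis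
      by eventually_elim simp
  qed
  obtain f where f: "f \<in> borel_measurable M" and fh: "\<And>U. U \<in> fmeasurable M \<Longrightarrow> AE x in M. x \<in> U \<longrightarrow> f x = h U x"
    using localizable_glue[OF loc h agree] by blast
  have "\<forall>\<^sub>F g in G. ldist M U f g < r" if U: "U \<in> fmeasurable M" and r: "0 < r" for U r
    using hl[OF U r] G(2)
  proof eventually_elim
    case (elim g)
    have "ldist M U f g = ldist M U (h U) g"
      using U f h[OF U] elim(2) fh[OF U] by (intro ldist_cong_AE) auto
    then show ?case
      using elim(1) by simp
  qed
  then show ?thesis
    using f by blast
qed

section \<open>The lower semicontinuous relaxation\<close>

lemma ennreal_less_add_pos:
  assumes "x < top" "0 < e"
  shows "x < x + ennreal e"
proof -
  obtain r where r: "x = ennreal r" "0 \<le> r"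
    using assms(1) by (cases x rule: ennreal_cases) auto
  have "ennreal r < ennreal (r + e)"
    using r(2) assms(2) by (simp add: ennreal_less_iff)
  then show ?thesis
    using r assms(2) by simp
qed

context L0_form
begin

text \<open>The lower limit of \<open>Q\<close> along the neighbourhoods of \<open>f\<close>, the
  point \<open>f\<close> included. Pairs of one set and one tolerance form a neighbourhood base,
  since finitely many sets of finite measure can be united.\<close>

definition relax :: "('a \<Rightarrow> real) \<Rightarrow> ennreal" where
  "relax f = (SUP i\<in>fmeasurable M \<times> {0<..}.
    INF g\<in>{g \<in> borel_measurable M. ldist M (fst i) f g < snd i}. Q g)"

lemma relax_approx:
  assumes "U \<in> fmeasurable M" "0 < \<delta>" "relax f < c"
  shows "\<exists>g\<in>borel_measurable M. ldist M U f g < \<delta> \<and> Q g < c"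
proof -
  have "(INF g\<in>{g \<in> borel_measurable M. ldist M U f g < \<delta>}. Q g) \<le> relax f"
    unfolding relax_def using assms(1,2) by (intro SUP_upper2[of "(U, \<delta>)"]) auto
  then have "(INF g\<in>{g \<in> borel_measurable M. ldist M U f g < \<delta>}. Q g) < c"
    using assms(3) by (rule le_less_trans)
  then show ?thesis
    unfolding INF_less_iff by blast
qed

lemma relax_le:
  assumes "\<And>U \<delta>. U \<in> fmeasurable M \<Longrightarrow> 0 < \<delta> \<Longrightarrow>
    \<exists>g\<in>borel_measurable M. ldist M U f g < \<delta> \<and> Q g \<le> c"
  shows "relax f \<le> c"
  unfolding relax_def
proof (rule SUP_least)
  fix i :: "'a set \<times> real" assume "i \<in> fmeasurable M \<times> {0<..}"
  then obtain g where g: "g \<in> borel_measurable M" "ldist M (fst i) f g < snd i" "Q g \<le> c"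
    using assms[of "fst i" "snd i"] by auto
  show "(INF g\<in>{g \<in> borel_measurable M. ldist M (fst i) f g < snd i}. Q g) \<le> c"
    using g by (intro INF_lower2[of g]) auto
qed

lemma relax_le_Q: "f \<in> borel_measurable M \<Longrightarrow> relax f \<le> Q f"
  by (rule relax_le) (intro bexI[of _ f]; simp)

text \<open>An approximant of an approximant is again one, at the cost of halving
  \<open>\<delta>\<close>. The slack \<open>e\<close> is there because the infima in
  \<open>relax\<close> need not be attained.\<close>

lemma relax_lsc:
  assumes f: "f \<in> borel_measurable M"
    and approx: "\<And>U \<delta>. U \<in> fmeasurable M \<Longrightarrow> 0 < \<delta> \<Longrightarrow>
      \<exists>h\<in>borel_measurable M. ldist M U f h < \<delta> \<and> relax h \<le> c"
  shows "relax f \<le> c"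
proof (rule ennreal_le_epsilon)
  fix e :: real assume c: "c < top" and e: "0 < e"
  show "relax f \<le> c + ennreal e"
  proof (rule relax_le)
    fix U and \<delta> :: real assume U: "U \<in> fmeasurable M" "0 < \<delta>"
    then obtain h where h: "h \<in> borel_measurable M" "ldist M U f h < \<delta> / 2" "relax h \<le> c"
      using approx[of U "\<delta> / 2"] by auto
    have "relax h < c + ennreal e"
      using h(3) ennreal_less_add_pos[OF c e] by (rule le_less_trans)
    then obtain g where g: "g \<in> borel_measurable M" "ldist M U h g < \<delta> / 2" "Q g < c + ennreal e"
      using relax_approx[of U "\<delta> / 2" h] U by auto
    have "ldist M U f g < \<delta>"
      using ldist_triangle[OF U(1) f g(1) h(1)] h(2) g(2) by linarith
    then show "\<exists>g\<in>borel_measurable M. ldist M U f g < \<delta> \<and> Q g \<le> c + ennreal e"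
      using g by (auto intro: less_imp_le)
  qed
qed

lemma relax_cong:
  assumes "f \<in> borel_measurable M" "g \<in> borel_measurable M" "AE x in M. f x = g x"
  shows "relax f = relax g"
proof -
  have "ldist M U f h = ldist M U g h" if "U \<in> fmeasurable M" "h \<in> borel_measurable M" for U h
    using that assms by (intro ldist_cong_AE) auto
  then show ?thesis
    unfolding relax_def by (intro SUP_cong refl arg_cong[where f = Inf] image_cong) auto
qed

lemma relax_scale_le:
  assumes f: "f \<in> borel_measurable M" and c: "c \<noteq> 0"
  shows "relax (\<lambda>x. c * f x) \<le> ennreal (c\<^sup>2) * relax f"
proof (rule ennreal_le_epsilon)
  fix e :: real assume fin: "ennreal (c\<^sup>2) * relax f < top" and e: "0 < e"
  have c2: "0 < c\<^sup>2"
    using c by simp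
  have "relax f < top"
    using fin c by (auto simp: ennreal_mult_less_top)
  then have less: "relax f < relax f + ennreal (e / c\<^sup>2)"
    using e c by (intro ennreal_less_add_pos) simp_all
  show "relax (\<lambda>x. c * f x) \<le> ennreal (c\<^sup>2) * relax f + ennreal e"
  proof (rule relax_le)
    fix U and \<delta> :: real assume U: "U \<in> fmeasurable M" "0 < \<delta>"
    have "0 < \<delta> / max 1 \<bar>c\<bar>"
      using U by simp
    then obtain g where g: "g \<in> borel_measurable M" "ldist M U f g < \<delta> / max 1 \<bar>c\<bar>"
        "Q g < relax f + ennreal (e / c\<^sup>2)"
      using relax_approx[OF U(1) _ less] by blast
    have "ldist M U (\<lambda>x. c * f x) (\<lambda>x. c * g x) \<le> max 1 \<bar>c\<bar> * ldist M U f g"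
      by (rule ldist_scale_le[OF U(1) f g(1)])
    also have "\<dots> < \<delta>"
      using g(2) by (simp add: field_simps less_max_iff_disj)
    finally have 1: "ldist M U (\<lambda>x. c * f x) (\<lambda>x. c * g x) < \<delta>" .
    have "Q (\<lambda>x. c * g x) \<le> ennreal (c\<^sup>2) * (relax f + ennreal (e / c\<^sup>2))"
      unfolding scale[OF g(1)] by (intro mult_left_mono less_imp_le[OF g(3)]) simp
    also have "\<dots> = ennreal (c\<^sup>2) * relax f + ennreal (c\<^sup>2) * ennreal (e / c\<^sup>2)"
      by (rule distrib_left)
    also have "ennreal (c\<^sup>2) * ennreal (e / c\<^sup>2) = ennreal e"
      using c e by (subst ennreal_mult[symmetric]) auto
    finally show "\<exists>g\<in>borel_measurable M. ldist M U (\<lambda>x. c * f x) g < \<delta> \<and> Q g \<le> ennreal (c\<^sup>2) * relax f + ennreal e"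
      using 1 g(1) by (intro bexI[of _ "\<lambda>x. c * g x"]) auto
  qed
qed

text \<open>For \<open>c \<noteq> 0\<close> equality follows from the inequality
  \<open>relax_scale_le\<close> by applying it also to \<open>1 / c\<close>.\<close>

lemma relax_scale:
  assumes f: "f \<in> borel_measurable M"
  shows "relax (\<lambda>x. c * f x) = ennreal (c\<^sup>2) * relax f"
proof (cases "c = 0")
  case True
  then show ?thesis
    using relax_le_Q[of "\<lambda>x. 0"] by (simp add: Q_zero)
next
  case False
  have cf: "(\<lambda>x. c * f x) \<in> borel_measurable M"
    using f by measurable
  have "relax f = relax (\<lambda>x. 1 / c * (c * f x))"
    using False by simp
  also have "\<dots> \<le> ennreal ((1 / c)\<^sup>2) * relax (\<lambda>x. c * f x)"
    using False by (intro relax_scale_le cf) simp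
  finally have "ennreal (c\<^sup>2) * relax f \<le> ennreal (c\<^sup>2) * (ennreal ((1 / c)\<^sup>2) * relax (\<lambda>x. c * f x))"
    by (intro mult_left_mono) auto
  also have "\<dots> = relax (\<lambda>x. c * f x)"
    using False by (simp add: mult.assoc[symmetric] ennreal_mult'[symmetric] power_divide)
  finally show ?thesis
    using relax_scale_le[OF f False] by (intro antisym)
qed

text \<open>If \<open>w\<close> and \<open>z\<close> approximate \<open>f\<close> and
  \<open>g\<close>, then \<open>w + z\<close> and \<open>w - z\<close> approximate the sum and the
  difference at the same index. The two suprema on the left can be taken over a common index because
  the family is directed.\<close>

lemma relax_para_le:
  assumes f: "f \<in> borel_measurable M" and g: "g \<in> borel_measurable M"
  shows "relax (\<lambda>x. f x + g x) + relax (\<lambda>x. f x - g x) \<le> 2 * relax f + 2 * relax g"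
proof (rule ennreal_le_epsilon)
  fix e :: real assume fin: "2 * relax f + 2 * relax g < top" and e: "0 < e"
  let ?I = "fmeasurable M \<times> {0<..} :: ('a set \<times> real) set"
  define J where "J h i = (INF w\<in>{w \<in> borel_measurable M. ldist M (fst i) h w < snd i}. Q w)" for h and i :: "'a set \<times> real"
  have relax_J: "relax h = (SUP i\<in>?I. J h i)" for h
    by (simp add: relax_def J_def)
  have J_mono: "J h (U, \<delta>) \<le> J h (V, \<eta>)"
    if "U \<in> sets M" "V \<in> fmeasurable M" "U \<subseteq> V" "\<eta> \<le> \<delta>" "h \<in> borel_measurable M" for h U V \<delta> \<eta>
    unfolding J_def fst_conv snd_conv
  proof (rule INF_superset_mono)
    show "{w \<in> borel_measurable M. ldist M V h w < \<eta>} \<subseteq> {w \<in> borel_measurable M. ldist M U h w < \<delta>}"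
      using ldist_mono_set[OF that(2,1,3,5)] that(4) by (auto intro: le_less_trans less_le_trans)
  qed simp
  have meas: "(\<lambda>x. f x + g x) \<in> borel_measurable M" "(\<lambda>x. f x - g x) \<in> borel_measurable M"
    using f g by measurable
  have "\<exists>k\<in>?I. J (\<lambda>x. f x + g x) i + J (\<lambda>x. f x - g x) j \<le> J (\<lambda>x. f x + g x) k + J (\<lambda>x. f x - g x) k"
    if ij: "i \<in> ?I" "j \<in> ?I" for i j
  proof -
    obtain U \<delta> V \<eta> where eq: "i = (U, \<delta>)" "j = (V, \<eta>)"
      by (cases i, cases j)
    have UV: "U \<in> fmeasurable M" "V \<in> fmeasurable M" "0 < \<delta>" "0 < \<eta>"
      using ij by (auto simp: eq)
    let ?k = "(U \<union> V, min \<delta> \<eta>)"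
    have "J (\<lambda>x. f x + g x) i \<le> J (\<lambda>x. f x + g x) ?k" "J (\<lambda>x. f x - g x) j \<le> J (\<lambda>x. f x - g x) ?k"
      unfolding eq using UV by (auto intro!: J_mono meas)
    moreover have "?k \<in> ?I"
      using UV by auto
    ultimately show ?thesis
      by (intro bexI[of _ ?k] add_mono)
  qed
  then have "relax (\<lambda>x. f x + g x) + relax (\<lambda>x. f x - g x) =
      (SUP i\<in>?I. J (\<lambda>x. f x + g x) i + J (\<lambda>x. f x - g x) i)"
    unfolding relax_J by (rule SUP_add_directed_ennreal[symmetric])
  also have "\<dots> \<le> 2 * relax f + 2 * relax g + ennreal e"
  proof (rule SUP_least)
    fix i assume i: "i \<in> ?I"
    obtain U \<delta> where eq: "i = (U, \<delta>)"
      by (cases i)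
    have U: "U \<in> fmeasurable M" "0 < \<delta>"
      using i by (auto simp: eq)
    have top: "relax f < top" "relax g < top"
      using fin by (auto simp: ennreal_mult_less_top)
    \<comment> \<open>Both tolerances are doubled by the parallelogram law, so four quarters add up
      to \<open>e\<close>.\<close>
    have "relax f < relax f + ennreal (e / 4)" "relax g < relax g + ennreal (e / 4)"
      using top e by (simp_all only: ennreal_less_add_pos divide_pos_pos zero_less_numeral)
    then obtain w z where w: "w \<in> borel_measurable M" "ldist M U f w < \<delta> / 2" "Q w < relax f + ennreal (e / 4)"
      and z: "z \<in> borel_measurable M" "ldist M U g z < \<delta> / 2" "Q z < relax g + ennreal (e / 4)"
      using relax_approx[OF U(1), of "\<delta> / 2"] U(2) by (metis half_gt_zero)
    have wz: "(\<lambda>x. w x + z x) \<in> borel_measurable M" "(\<lambda>x. w x - z x) \<in> borel_measurable M"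
      using w(1) z(1) by measurable
    have "ldist M U (\<lambda>x. f x + g x) (\<lambda>x. w x + z x) \<le> ldist M U f w + ldist M U g z"
      "ldist M U (\<lambda>x. f x - g x) (\<lambda>x. w x - z x) \<le> ldist M U f w + ldist M U g z"
      by (intro ldist_le_add U meas wz f g w z, auto simp: min_def)+
    then have "J (\<lambda>x. f x + g x) i \<le> Q (\<lambda>x. w x + z x)" "J (\<lambda>x. f x - g x) i \<le> Q (\<lambda>x. w x - z x)"
      unfolding J_def eq using w(2) z(2) wz by (auto intro!: INF_lower)
    then have "J (\<lambda>x. f x + g x) i + J (\<lambda>x. f x - g x) i \<le> 2 * Q w + 2 * Q z"
      unfolding para[OF w(1) z(1)] by (rule add_mono)
    also have "\<dots> \<le> 2 * (relax f + ennreal (e / 4)) + 2 * (relax g + ennreal (e / 4))"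
      using w(3) z(3) by (intro add_mono mult_left_mono less_imp_le) auto
    also have "\<dots> = 2 * relax f + 2 * relax g + (2 * ennreal (e / 4) + 2 * ennreal (e / 4))"
      by (simp add: distrib_left add_ac)
    also have "2 * ennreal (e / 4) + 2 * ennreal (e / 4) = ennreal e"
    proof -
      have "2 * ennreal (e / 4) = ennreal 2 * ennreal (e / 4)"
        by simp
      also have "\<dots> = ennreal (e / 2)"
        using e by (subst ennreal_mult[symmetric]) auto
      finally show ?thesis
        using e by (simp add: ennreal_plus[symmetric] del: ennreal_plus)
    qed
    finally show "J (\<lambda>x. f x + g x) i + J (\<lambda>x. f x - g x) i \<le> 2 * relax f + 2 * relax g + ennreal e" .
  qed
  finally show "relax (\<lambda>x. f x + g x) + relax (\<lambda>x. f x - g x) \<le> 2 * relax f + 2 * relax g + ennreal e" .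
qed

text \<open>The reverse inequality is \<open>relax_para_le\<close> for \<open>f + g\<close> and
  \<open>f - g\<close>, whose sum and difference are \<open>2 f\<close> and \<open>2 g\<close>;
  homogeneity and division by \<open>2\<close> finish it.\<close>

lemma relax_para:
  assumes f: "f \<in> borel_measurable M" and g: "g \<in> borel_measurable M"
  shows "2 * relax f + 2 * relax g = relax (\<lambda>x. f x + g x) + relax (\<lambda>x. f x - g x)"
proof (rule antisym[OF _ relax_para_le[OF f g]])
  have meas: "(\<lambda>x. f x + g x) \<in> borel_measurable M" "(\<lambda>x. f x - g x) \<in> borel_measurable M"
    using f g by measurable
  have "(\<lambda>x. (f x + g x) + (f x - g x)) = (\<lambda>x. 2 * f x)" "(\<lambda>x. (f x + g x) - (f x - g x)) = (\<lambda>x. 2 * g x)"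
    by auto
  then have "ennreal (2\<^sup>2) * relax f + ennreal (2\<^sup>2) * relax g \<le>
      2 * relax (\<lambda>x. f x + g x) + 2 * relax (\<lambda>x. f x - g x)"
    using relax_para_le[OF meas] relax_scale[OF f, of 2] relax_scale[OF g, of 2] by simp
  moreover have "ennreal (2\<^sup>2) = 2 * 2"
    by simp
  ultimately have "2 * (2 * relax f + 2 * relax g) \<le> 2 * (relax (\<lambda>x. f x + g x) + relax (\<lambda>x. f x - g x))"
    by (simp only: distrib_left mult.assoc)
  then show "2 * relax f + 2 * relax g \<le> relax (\<lambda>x. f x + g x) + relax (\<lambda>x. f x - g x)"
    by (subst (asm) ennreal_mult_le_mult_iff) auto
qed

section \<open>The relaxation as a closed form on classes\<close>

lemma relax_rep_ae_class:
  assumes "f \<in> borel_measurable M"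
  shows "relax (rep (ae_class M f)) = relax f"
  using rep_ae_class[OF assms] assms by (intro relax_cong)

lemma quadratic_form_relax: "quadratic_form (L0_space M) (\<lambda>u. relax (rep u))"
  unfolding quadratic_form_def vcarrier_L0_space
proof (intro conjI ballI allI)
  fix u assume u: "u \<in> L0_classes M"
  note f = rep_measurable[OF u]
  show "relax (rep (vscale (L0_space M) c u)) = ennreal (\<bar>c\<bar>\<^sup>2) * relax (rep u)" for c
  proof -
    have "vscale (L0_space M) c u = ae_class M (\<lambda>x. c * rep u x)"
      using vscale_ae_class[OF f, of c] by (simp only: ae_class_rep[OF u])
    then show ?thesis
      using f by (simp add: relax_rep_ae_class relax_scale)
  qed
  fix v assume v: "v \<in> L0_classes M"
  note g = rep_measurable[OF v]
  have "vadd (L0_space M) u v = ae_class M (\<lambda>x. rep u x + rep v x)"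
    "vdiff (L0_space M) u v = ae_class M (\<lambda>x. rep u x - rep v x)"
    using vadd_ae_class[OF f g] vdiff_ae_class[OF f g] by (simp_all only: ae_class_rep[OF u] ae_class_rep[OF v])
  then show "2 * relax (rep u) + 2 * relax (rep v) =
      relax (rep (vadd (L0_space M) u v)) + relax (rep (vdiff (L0_space M) u v))"
    using f g by (simp add: relax_rep_ae_class relax_para)
qed

text \<open>A Cauchy filter for the form topology has a limit \<open>f\<close> in \<open>L0\<close>.
  Convergence in energy follows by fixing \<open>u\<close> and letting \<open>v\<close> tend to
  \<open>f\<close> in the bound on \<open>u - v\<close>, which lower semicontinuity
  preserves.\<close>

lemma closed_form_relax:
  assumes loc: "localizable M"
  shows "closed_form (L0_space M) (\<lambda>u. relax (rep u))"
  unfolding closed_form_def vcomplete_def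
proof (intro conjI allI impI)
  show "quadratic_form (L0_space M) (\<lambda>u. relax (rep u))"
    by (rule quadratic_form_relax)
  then interpret c: L0_class_form M "\<lambda>u. relax (rep u)"
    by unfold_locales
  let ?V = "L0_space M" and ?T = "form_topology (L0_space M) (\<lambda>u. relax (rep u))"
  let ?D = "form_domain (L0_space M) (\<lambda>u. relax (rep u))"
  fix F assume F: "F \<le> principal (topspace ?T)" "F \<noteq> bot" "vcauchy_filter ?V ?T F"
  let ?z = "ae_class M (\<lambda>x. 0)"
  have D_eq: "ae_class M (rep v) = v" if "v \<in> ?D" for v
    using that by (simp add: form_domain_def vcarrier_L0_space ae_class_rep)
  have ev_D: "\<forall>\<^sub>F u in F. u \<in> ?D"
    using F(1) by (simp add: le_principal c.topspace_form_topology)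
  have zD: "?z \<in> ?D"
    using c.form_domain_iff[of "\<lambda>x. 0"] c.dom_zero by simp
  have ev: "\<forall>\<^sub>F v in nhdsin ?T ?z. v \<in> ?D"
    using zD unfolding eventually_nhdsin c.topspace_form_topology
    by (metis c.topspace_form_topology openin_topspace)
  \<comment> \<open>The identity tends to zero along the neighbourhood filter of zero. Feeding this
    into the description of limits shows that \<open>ldist\<close> balls and \<open>q\<close> balls
    are neighbourhoods of zero, without analysing open sets.\<close>
  have "limitin ?T (\<lambda>v. ae_class M (rep v)) ?z (nhdsin ?T ?z)"
    unfolding limitin_def c.topspace_form_topology
  proof (intro conjI allI impI zD)
    fix W assume W: "openin ?T W \<and> ?z \<in> W"
    have "ae_class M (rep v) \<in> W" if "v \<in> W" for v
    proof -
      have "v \<in> ?D"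
        using openin_subset[of ?T W] W that by (auto simp: c.topspace_form_topology)
      then show ?thesis
        using that by (simp add: D_eq)
    qed
    then show "\<forall>\<^sub>F v in nhdsin ?T ?z. ae_class M (rep v) \<in> W"
      using W unfolding eventually_nhdsin by blast
  qed
  moreover have "\<forall>\<^sub>F v in nhdsin ?T ?z. rep v \<in> c.dom"
    using ev by eventually_elim (rule c.rep_in_dom)
  ultimately have near_zero:
      "\<And>U r. U \<in> fmeasurable M \<Longrightarrow> 0 < r \<Longrightarrow> \<forall>\<^sub>F v in nhdsin ?T ?z. ldist M U (\<lambda>x. 0) (rep v) < r"
      "\<And>r. 0 < r \<Longrightarrow> \<forall>\<^sub>F v in nhdsin ?T ?z. sqrt (c.q (\<lambda>x. 0 - rep v x)) < r"
    by (auto simp: c.limitin_form_topology[OF c.dom_zero])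
  \<comment> \<open>Every property that holds near zero holds for all differences within some member
    of \<open>F\<close>; it is used once for \<open>ldist\<close> and once for the energy.\<close>
  have cauchy: "\<exists>P. eventually P F \<and> (\<forall>u v. P u \<longrightarrow> P v \<longrightarrow> u \<in> ?D \<and> R (vdiff ?V u v))"
    if R: "\<forall>\<^sub>F v in nhdsin ?T ?z. R v" for R
  proof -
    obtain W where W: "openin ?T W" "?z \<in> W" "\<And>v. v \<in> W \<Longrightarrow> R v"
      using R zD unfolding eventually_nhdsin c.topspace_form_topology by blast
    moreover have "vzero ?V = ?z"
      by (simp add: L0_space_def)
    ultimately have "\<forall>\<^sub>F (u, v) in F \<times>\<^sub>F F. vdiff ?V u v \<in> W"
      using F(3) unfolding vcauchy_filter_def by simp
    then obtain P where P: "eventually P F" "\<And>u v. P u \<Longrightarrow> P v \<Longrightarrow> vdiff ?V u v \<in> W"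
      unfolding eventually_prod_same by auto
    have "\<forall>\<^sub>F u in F. P u \<and> u \<in> ?D"
      using P(1) ev_D by (rule eventually_conj)
    then show ?thesis
      using P(2) W(3) by (intro exI[of _ "\<lambda>u. P u \<and> u \<in> ?D"]) auto
  qed
  have rep_vdiff: "rep (vdiff ?V u v) \<in> borel_measurable M"
      "AE x in M. rep (vdiff ?V u v) x = rep u x - rep v x" if "u \<in> ?D" "v \<in> ?D" for u v
  proof -
    note m = that[THEN c.rep_in_dom, THEN c.dom_measurable]
    have "vdiff ?V u v = ae_class M (\<lambda>x. rep u x - rep v x)"
      using vdiff_ae_class[OF m] by (simp only: D_eq that)
    then show "rep (vdiff ?V u v) \<in> borel_measurable M" "AE x in M. rep (vdiff ?V u v) x = rep u x - rep v x"
      using rep_ae_class[of "\<lambda>x. rep u x - rep v x" M] m by auto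
  qed
  have cauchy_ldist: "\<exists>P. eventually P F \<and> (\<forall>u v. P u \<longrightarrow> P v \<longrightarrow> u \<in> ?D \<and> ldist M U (rep u) (rep v) < r)"
    if U: "U \<in> fmeasurable M" and r: "0 < r" for U r
  proof -
    obtain P where P: "eventually P F"
      "\<And>u v. P u \<Longrightarrow> P v \<Longrightarrow> u \<in> ?D \<and> ldist M U (\<lambda>x. 0) (rep (vdiff ?V u v)) < r"
      using cauchy[OF near_zero(1)[OF U r]] by blast
    have "ldist M U (\<lambda>x. 0) (rep (vdiff ?V u v)) = ldist M U (rep u) (rep v)" if "u \<in> ?D" "v \<in> ?D" for u v
    proof -
      note m = that[THEN c.rep_in_dom, THEN c.dom_measurable]
      have "ldist M U (\<lambda>x. 0) (rep (vdiff ?V u v)) = ldist M U (\<lambda>x. 0) (\<lambda>x. rep u x - rep v x)"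
        using rep_vdiff[OF that] U m by (intro ldist_cong_AE) auto
      also have "\<dots> = ldist M U (rep u) (rep v)"
        by (simp add: ldist_def abs_minus_commute)
      finally show ?thesis .
    qed
    then show ?thesis
      using P by metis
  qed
  have cauchy_q: "\<exists>P. eventually P F \<and> (\<forall>u v. P u \<longrightarrow> P v \<longrightarrow> u \<in> ?D \<and> sqrt (c.q (\<lambda>x. rep u x - rep v x)) < r)"
    if r: "0 < r" for r
  proof -
    obtain P where P: "eventually P F"
      "\<And>u v. P u \<Longrightarrow> P v \<Longrightarrow> u \<in> ?D \<and> sqrt (c.q (\<lambda>x. 0 - rep (vdiff ?V u v) x)) < r"
      using cauchy[OF near_zero(2)[OF r]] by blast
    have "c.q (\<lambda>x. 0 - rep (vdiff ?V u v) x) = c.q (\<lambda>x. rep v x - rep u x)" if "u \<in> ?D" "v \<in> ?D" for u v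
    proof -
      note m = that[THEN c.rep_in_dom, THEN c.dom_measurable]
      have "AE x in M. 0 - rep (vdiff ?V u v) x = rep v x - rep u x"
        using rep_vdiff(2)[OF that] by eventually_elim simp
      then show ?thesis
        unfolding c.q_def using rep_vdiff(1)[OF that] m
        by (intro arg_cong[where f = enn2real] c.cong) auto
    qed
    note eq = this
    have "u \<in> ?D \<and> sqrt (c.q (\<lambda>x. rep u x - rep v x)) < r" if "P u" "P v" for u v
      using P(2)[OF that(2,1)] P(2)[OF that] eq[of v u] by simp
    then show ?thesis
      using P(1) by blast
  qed
  define G where "G = filtermap rep F"
  have "\<exists>f\<in>borel_measurable M. \<forall>U\<in>fmeasurable M. \<forall>r>0. \<forall>\<^sub>F g in G. ldist M U f g < r"
  proof (rule L0_complete[OF loc])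
    show "G \<noteq> bot"
      using F(2) by (simp add: G_def filtermap_bot_iff)
    show "\<forall>\<^sub>F g in G. g \<in> borel_measurable M"
      unfolding G_def eventually_filtermap
      using ev_D by eventually_elim (intro c.dom_measurable c.rep_in_dom)
    show "\<exists>P. eventually P G \<and> (\<forall>f g. P f \<longrightarrow> P g \<longrightarrow> ldist M U f g < r)"
      if Ur: "U \<in> fmeasurable M" "0 < r" for U r
    proof -
      obtain P where P: "eventually P F" "\<And>u v. P u \<Longrightarrow> P v \<Longrightarrow> ldist M U (rep u) (rep v) < r"
        using cauchy_ldist[OF Ur] by blast
      have "eventually (\<lambda>f. \<exists>u. P u \<and> f = rep u) G"
        unfolding G_def eventually_filtermap using P(1) by eventually_elim blast
      then show ?thesis
        using P(2) by (intro exI[of _ "\<lambda>f. \<exists>u. P u \<and> f = rep u"]) auto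
    qed
  qed
  then obtain f where f: "f \<in> borel_measurable M"
    and fl: "\<And>U r. U \<in> fmeasurable M \<Longrightarrow> 0 < r \<Longrightarrow> \<forall>\<^sub>F u in F. ldist M U f (rep u) < r"
    unfolding G_def eventually_filtermap by blast
  \<comment> \<open>The functions \<open>u - v\<close> tend to \<open>u - f\<close> locally in
    measure as \<open>v\<close> runs along \<open>F\<close> inside \<open>P\<close>, and their
    energies stay below \<open>r\<^sup>2\<close>. The strict bound becomes a weak one in the
    limit.\<close>
  have close: "(\<lambda>x. rep u x - f x) \<in> c.dom \<and> sqrt (c.q (\<lambda>x. rep u x - f x)) \<le> r"
    if r: "0 < r" and P: "eventually P F" "P u"
      and Pq: "\<And>u v. P u \<Longrightarrow> P v \<Longrightarrow> u \<in> ?D \<and> sqrt (c.q (\<lambda>x. rep u x - rep v x)) < r" for P u r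
  proof -
    have u: "rep u \<in> c.dom"
      using Pq[OF P(2) P(2)] by (simp add: c.rep_in_dom)
    note um = c.dom_measurable[OF u]
    have m: "(\<lambda>x. rep u x - f x) \<in> borel_measurable M"
      using um f by measurable
    have "relax (\<lambda>x. rep u x - f x) \<le> ennreal (r\<^sup>2)"
    proof (rule relax_lsc[OF m])
      fix U and \<delta> :: real assume U: "U \<in> fmeasurable M" "0 < \<delta>"
      have "\<forall>\<^sub>F v in F. P v \<and> ldist M U f (rep v) < \<delta>"
        using P(1) fl[OF U] by (rule eventually_conj)
      then obtain v where v: "P v" "ldist M U f (rep v) < \<delta>"
        using eventually_happens'[OF F(2)] by blast
      have vd: "rep v \<in> c.dom"
        using Pq[OF v(1) v(1)] by (simp add: c.rep_in_dom)
      let ?h = "\<lambda>x. rep u x - rep v x"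
      have hd: "?h \<in> c.dom"
        by (rule c.dom_add_diff(2)[OF u vd])
      note hm = c.dom_measurable[OF hd]
      have "ldist M U (\<lambda>x. rep u x - f x) ?h \<le> ldist M U f (rep v)"
        by (rule ldist_le[OF U(1) m hm f c.dom_measurable[OF vd]]) simp
      moreover have "relax ?h = ennreal (c.q ?h)"
        using c.Q_eq_q[OF hd] by (simp add: relax_rep_ae_class[OF hm])
      moreover have "c.q ?h \<le> r\<^sup>2"
        using Pq[OF P(2) v(1)] r by (intro sqrt_le_D) auto
      ultimately show "\<exists>h\<in>borel_measurable M. ldist M U (\<lambda>x. rep u x - f x) h < \<delta> \<and> relax h \<le> ennreal (r\<^sup>2)"
        using v(2) hm by (intro bexI[of _ ?h]) (auto intro: ennreal_leI)
    qed
    then have "relax (rep (ae_class M (\<lambda>x. rep u x - f x))) \<le> ennreal (r\<^sup>2)"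
      by (simp only: relax_rep_ae_class[OF m])
    then show ?thesis
      using c.dom_le[OF m] c.q_le[of "r\<^sup>2" "\<lambda>x. rep u x - f x"] r by (auto intro: real_le_lsqrt)
  qed
  have fd: "f \<in> c.dom"
  proof -
    obtain P where P: "eventually P F"
      "\<And>u v. P u \<Longrightarrow> P v \<Longrightarrow> u \<in> ?D \<and> sqrt (c.q (\<lambda>x. rep u x - rep v x)) < 1"
      using cauchy_q[of 1] by auto
    obtain u where u: "P u"
      using eventually_happens'[OF F(2) P(1)] by blast
    have "(\<lambda>x. rep u x - (rep u x - f x)) \<in> c.dom"
      by (rule c.dom_add_diff(2)[OF c.rep_in_dom[OF conjunct1[OF P(2)[OF u u]]]
            conjunct1[OF close[OF zero_less_one P(1) u P(2)]]])
    then show ?thesis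
      by simp
  qed
  have "\<forall>\<^sub>F u in F. sqrt (c.q (\<lambda>x. f x - rep u x)) < r" if r: "0 < r" for r
  proof -
    obtain P where P: "eventually P F"
      "\<And>u v. P u \<Longrightarrow> P v \<Longrightarrow> u \<in> ?D \<and> sqrt (c.q (\<lambda>x. rep u x - rep v x)) < r / 2"
      using cauchy_q[of "r / 2"] r by auto
    show ?thesis
      using P(1)
    proof eventually_elim
      case (elim u)
      have "rep u \<in> c.dom"
        using P(2)[OF elim elim] by (simp add: c.rep_in_dom)
      then show ?case
        using close[OF _ P(1) elim P(2)] r by (simp add: c.q_minus_commute[OF fd])
    qed
  qed
  moreover have "\<forall>\<^sub>F u in F. rep u \<in> c.dom"
    using ev_D by eventually_elim (rule c.rep_in_dom)
  ultimately have "limitin ?T (\<lambda>u. ae_class M (rep u)) (ae_class M f) F"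
    using fl by (subst c.limitin_form_topology[OF fd]) auto
  moreover have "\<forall>\<^sub>F u in F. ae_class M (rep u) = u"
    using ev_D by eventually_elim (rule D_eq)
  ultimately have "limitin ?T (\<lambda>u. u) (ae_class M f) F"
    by (rule limitin_transform_eventually[rotated])
  then show "\<exists>u. limitin ?T (\<lambda>v. v) u F"
    by blast
qed

end

section \<open>Agreement of the relaxation with the Dirichlet form on its domain\<close>

context L2_dirichlet_form
begin

text \<open>The nontrivial inequality is \<open>lsc_L0\<close>, applied with a real constant
  slightly above \<open>relax f\<close>: every neighbourhood of \<open>f\<close> contains functions
  of energy below it, and these lie in \<open>dom\<close>.\<close>

lemma relax_eq:
  assumes f: "f \<in> dom"
  shows "relax f = extend_to_L0 M E (ae_class M f)"
proof (rule antisym)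
  show "relax f \<le> extend_to_L0 M E (ae_class M f)"
    by (rule relax_le_Q[OF dom_measurable[OF f]])
  show "extend_to_L0 M E (ae_class M f) \<le> relax f"
  proof (rule ennreal_le_epsilon)
    fix e :: real assume fin: "relax f < top" and e: "0 < e"
    define c where "c = enn2real (relax f) + e"
    have c: "ennreal c = relax f + ennreal e"
      using fin e by (simp add: c_def)
    have less: "relax f < ennreal c"
      unfolding c using fin e by (rule ennreal_less_add_pos)
    have "q f \<le> c"
    proof (rule lsc_L0[OF f])
      fix U and \<delta> :: real assume U: "U \<in> fmeasurable M" "0 < \<delta>"
      obtain g where g: "g \<in> borel_measurable M" "ldist M U f g < \<delta>" "extend_to_L0 M E (ae_class M g) < ennreal c"
        using relax_approx[OF U less] by blast
      have "0 \<le> c"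
        using e by (simp add: c_def)
      then show "\<exists>d\<in>dom. ldist M U f d < \<delta> \<and> q d \<le> c"
        using g dom_le[OF g(1) less_imp_le[OF g(3)]] q_le[OF _ less_imp_le[OF g(3)]] by blast
    qed
    then show "extend_to_L0 M E (ae_class M f) \<le> relax f + ennreal e"
      unfolding Q_eq_q[OF f] c[symmetric] by (rule ennreal_leI)
  qed
qed

lemma form_extends_relax:
  "form_extends (L0_space M) (\<lambda>u. relax (rep u)) (extend_to_L0 M E)"
proof -
  have "relax (rep u) = extend_to_L0 M E u" if "u \<in> form_domain (L0_space M) (extend_to_L0 M E)" for u
    using relax_eq[OF rep_in_dom[OF that]] that
    by (simp add: form_domain_def vcarrier_L0_space ae_class_rep)
  then show ?thesis
    by (auto simp: form_extends_def form_domain_def)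
qed

end

theorem theorem1p59:
  fixes M :: "'a measure" and \<E> :: "('a \<Rightarrow> real) set \<Rightarrow> ennreal"
  assumes "localizable M"
    and "dirichlet_form M \<E>"
  shows "closable_form (L0_space M) (extend_to_L0 M \<E>)"
proof -
  interpret L2_dirichlet_form M \<E>
    by standard (use assms(2) in \<open>simp_all add: dirichlet_form_def\<close>)
  show ?thesis
    unfolding closable_form_def using closed_form_relax[OF assms(1)] form_extends_relax by blast
qed

end
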